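(* There exists $\varepsilon_0>0$ such that for every $\varepsilon\in(0,\varepsilon_0)$, the $\infty$-harmonic potential $v_\varepsilon$ of the domain $S_\varepsilon$ is not a first $\infty$-eigenfunction of $S_\varepsilon$. In particular, there exists a bounded convex domain in $\mathbb{R}^2$ whose $\infty$-harmonic potential is not a first $\infty$-eigenfunction.
   Context: For $\varepsilon\ge 0$, let $S_\varepsilon\subset\mathbb{R}^2$ be the convex hull of the two disks $B_{1+\varepsilon}(-1,0)$ and $B_1(1,0)$, where $B_r(x)$ is the open disk of radius $r$ centered at $x$. Equivalently, $S_\varepsilon$ is the union of these two disks and the region $R$ between the two line segments joining $(-1,1+\varepsilon)$ to $(1,1)$ and $(-1,-(1+\varepsilon))$ to $(1,-1)$. In particular $S_0$ is a stadium. For a bounded domain $\Omega\subset\mathbb{R}^n$, let $\delta(x)=\operatorname{dist}(x,\partial\Omega)$, and define the High ridge $\Gamma=\{x\in\Omega:\delta(x)=\max_{\Omega}\delta\}$. Set $\Lambda=\left(\sup\{r: B_r(x)\subset\Omega \text{ for some } x\in\Omega\}\right)^{-1}$. Let $\Delta_\infty u=\sum_{i,j=1}^n u_{x_i}u_{x_j}u_{x_ix_j}$ denote the infinity Laplacian. A non-negative function $u\in C(\overline\Omega)$ with $u=0$ on $\partial\Omega$ is a first $\infty$-eigenfunction of $\Omega$ if it solves, in the viscosity sense, $$\max\left(\Lambda-\frac{|\nabla u|}{u},\ \Delta_\infty u\right)=0 \quad\text{in }\Omega.$$ The $\infty$-harmonic potential of $\Omega$ is the function $v\in C(\overline\Omega)$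 satisfying $\Delta_\infty v=0$ in the viscosity sense in $\Omega\setminus\Gamma$, $v=0$ on $\partial\Omega$, and $v=1$ on $\Gamma$. For $\varepsilon>0$, the High ridge of $S_\varepsilon$ is the single point $(-1,0)$. *)

theory Defs
  imports "HOL-Analysis.Analysis"
begin

type_synonym pt = "real ^ 2"

definition S_dom :: "real \<Rightarrow> pt set" where
  "S_dom e = convex hull (ball (vector [-1, 0]) (1 + e) \<union> ball (vector [1, 0]) 1)"

definition bdist :: "pt set \<Rightarrow> pt \<Rightarrow> real" where
  "bdist \<Omega> x = infdist x (frontier \<Omega>)"

definition high_ridge :: "pt set \<Rightarrow> pt set" where
  "high_ridge \<Omega> = {x \<in> \<Omega>. bdist \<Omega> x = (SUP y\<in>\<Omega>. bdist \<Omega> y)}"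

definition Lam :: "pt set \<Rightarrow> real" where
  "Lam \<Omega> = inverse (Sup {r. \<exists>x\<in>\<Omega>. ball x r \<subseteq> \<Omega>})"

definition C2_on :: "pt set \<Rightarrow> (pt \<Rightarrow> real) \<Rightarrow> (pt \<Rightarrow> pt) \<Rightarrow> (pt \<Rightarrow> real^2^2) \<Rightarrow> bool" where
  "C2_on U \<phi> G H \<longleftrightarrow>
     (\<forall>x\<in>U. (\<phi> has_derivative (\<lambda>h. G x \<bullet> h)) (at x)) \<and>
     (\<forall>x\<in>U. (G has_derivative (\<lambda>h. H x *v h)) (at x)) \<and>
     continuous_on U H"

definition inf_lap :: "(pt \<Rightarrow> pt) \<Rightarrow> (pt \<Rightarrow> real^2^2) \<Rightarrow> pt \<Rightarrow> real" where
  "inf_lap G H x = G x \<bullet> (H x *v G x)"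

definition touches_below :: "(pt \<Rightarrow> real) \<Rightarrow> (pt \<Rightarrow> real) \<Rightarrow> pt \<Rightarrow> bool" where
  "touches_below \<phi> u x0 \<longleftrightarrow> \<phi> x0 = u x0 \<and> (\<exists>r>0. \<forall>y\<in>ball x0 r. \<phi> y \<le> u y)"

definition touches_above :: "(pt \<Rightarrow> real) \<Rightarrow> (pt \<Rightarrow> real) \<Rightarrow> pt \<Rightarrow> bool" where
  "touches_above \<phi> u x0 \<longleftrightarrow> \<phi> x0 = u x0 \<and> (\<exists>r>0. \<forall>y\<in>ball x0 r. u y \<le> \<phi> y)"

definition visc_inf_harmonic :: "pt set \<Rightarrow> (pt \<Rightarrow> real) \<Rightarrow> bool" where
  "visc_inf_harmonic U v \<longleftrightarrow>
     (\<forall>x0\<in>U. \<forall>\<phi> G H. C2_on U \<phi> G H \<and> touches_below \<phi> v x0 \<longrightarrow> inf_lap G H x0 \<le> 0) \<and>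
     (\<forall>x0\<in>U. \<forall>\<phi> G H. C2_on U \<phi> G H \<and> touches_above \<phi> v x0 \<longrightarrow> inf_lap G H x0 \<ge> 0)"

definition visc_inf_eigen_eq :: "real \<Rightarrow> pt set \<Rightarrow> (pt \<Rightarrow> real) \<Rightarrow> bool" where
  "visc_inf_eigen_eq \<Lambda> U u \<longleftrightarrow>
     (\<forall>x0\<in>U. \<forall>\<phi> G H. C2_on U \<phi> G H \<and> touches_below \<phi> u x0 \<longrightarrow>
        max (\<Lambda> - norm (G x0) / \<phi> x0) (inf_lap G H x0) \<le> 0) \<and>
     (\<forall>x0\<in>U. \<forall>\<phi> G H. C2_on U \<phi> G H \<and> touches_above \<phi> u x0 \<longrightarrow>
        max (\<Lambda> - norm (G x0) / \<phi> x0) (inf_lap G H x0) \<ge> 0)"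

definition first_inf_eigenfunction :: "pt set \<Rightarrow> (pt \<Rightarrow> real) \<Rightarrow> bool" where
  "first_inf_eigenfunction \<Omega> u \<longleftrightarrow>
     continuous_on (closure \<Omega>) u \<and> (\<forall>x\<in>closure \<Omega>. u x \<ge> 0) \<and>
     (\<forall>x\<in>frontier \<Omega>. u x = 0) \<and> visc_inf_eigen_eq (Lam \<Omega>) \<Omega> u"

definition inf_harmonic_potential :: "pt set \<Rightarrow> (pt \<Rightarrow> real) \<Rightarrow> bool" where
  "inf_harmonic_potential \<Omega> v \<longleftrightarrow>
     continuous_on (closure \<Omega>) v \<and> visc_inf_harmonic (\<Omega> - high_ridge \<Omega>) v \<and>
     (\<forall>x\<in>frontier \<Omega>. v x = 0) \<and> (\<forall>x\<in>high_ridge \<Omega>. v x = 1)"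

end

theory Submission
  imports Defs
begin

text \<open>Write \<open>p = (-1,0)\<close>, \<open>\<Lambda> = 1/(1+\<epsilon>)\<close>, \<open>r = norm (x - p)\<close>, and suppose that \<open>v\<close> is both the potential and an
  eigenfunction. The two properties are incompatible near \<open>p\<close>.
  Since \<open>norm (\<nabla>v) \<ge> \<Lambda> v\<close> and \<open>v \<le> 1\<close>, comparison with cones from above on the ball around \<open>x\<close> through \<open>p\<close>
  gives \<open>v x * (1 + \<Lambda> r) \<le> 1\<close>, so \<open>v \<le> 1 - \<Lambda> r + O(r\<^sup>2)\<close>.
  On the other hand \<open>v \<ge> 1 - \<Lambda> r\<close> on the disk of radius \<open>1 + \<epsilon>\<close> around \<open>p\<close>, strictly at its boundary point
  \<open>(\<epsilon>,0)\<close>, which lies in the domain. In a thin sector around the axis this gain propagates to \<open>p\<close>: with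
  \<open>\<theta>\<close> the angle to the axis, \<open>1 - \<Lambda> r + a r powr (3/2) (cos \<theta> - c)\<^sup>2\<close> is strictly infinity-subharmonic for
  small \<open>a\<close>, hence lies below \<open>v\<close>, and on the axis \<open>r powr (3/2)\<close> beats \<open>r\<^sup>2\<close>.\<close>

section \<open>Comparison principles\<close>

lemma C2_on_quadratic:
  fixes A :: "real^2^2" and x g :: pt
  defines "S \<equiv> (1/2) *\<^sub>R (A + transpose A)"
  shows "C2_on U (\<lambda>y. k + g \<bullet> (y - x) + ((y - x) \<bullet> (A *v (y - x))) / 2)
            (\<lambda>y. g + S *v (y - x)) (\<lambda>_. S)"
proof -
  have lin: "bounded_linear ((*v) M)" for M :: "real^2^2"
    by simp
  have S: "(S *v d) \<bullet> h = (h \<bullet> (A *v d) + d \<bullet> (A *v h)) / 2" for d h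
    unfolding S_def
    by (simp add: scaleR_matrix_vector_assoc[symmetric] matrix_vector_mult_add_rdistrib inner_add_left
        dot_lmul_matrix inner_commute[of "A *v d" h])
  show ?thesis
    unfolding C2_on_def
  proof (intro conjI ballI)
    fix y
    show "((\<lambda>y. k + g \<bullet> (y - x) + ((y - x) \<bullet> (A *v (y - x))) / 2)
        has_derivative (\<lambda>h. (g + S *v (y - x)) \<bullet> h)) (at y)"
      by (auto intro!: derivative_eq_intros bounded_linear.has_derivative[OF lin]
          simp: inner_add_left S add_divide_distrib)
    show "((\<lambda>y. g + S *v (y - x)) has_derivative (*v) S) (at y)"
      by (auto intro!: derivative_eq_intros bounded_linear.has_derivative[OF lin])
  qed simp
qed

text \<open>A Taylor expansion from differentiability of the gradient \<open>G\<close> at the single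
  point \<open>x\<close>: the mean value theorem is applied along a segment to \<open>f\<close>
  minus its quadratic model.\<close>

lemma second_order_expansion:
  fixes f :: "'a::real_inner \<Rightarrow> real"
  assumes "open N" "x \<in> N"
    and f: "\<And>y. y \<in> N \<Longrightarrow> (f has_derivative (\<lambda>h. G y \<bullet> h)) (at y)"
    and G: "(G has_derivative L) (at x)" and "\<eta> > 0"
  shows "\<exists>r>0. \<forall>h. norm h < r \<longrightarrow> \<bar>f (x + h) - f x - G x \<bullet> h - (h \<bullet> L h) / 2\<bar> \<le> \<eta> * (norm h)\<^sup>2"
proof -
  from G \<open>\<eta> > 0\<close> obtain d where d: "d > 0" and L: "bounded_linear L"
    and dG: "\<And>y. norm (y - x) < d \<Longrightarrow> norm (G y - G x - L (y - x)) \<le> \<eta> * norm (y - x)"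
    unfolding has_derivative_at_alt by blast
  obtain r' where r': "r' > 0" "ball x r' \<subseteq> N"
    using assms(1,2) open_contains_ball by blast
  show ?thesis
  proof (intro exI[of _ "min d r'"] conjI allI impI)
    fix h :: 'a assume h: "norm h < min d r'"
    \<comment> \<open>The derivative of this remainder at \<open>t\<close> is the linearization
      error of \<open>G\<close> at \<open>x + t *\<^sub>R h\<close>, paired with
      \<open>h\<close>.\<close>
    define \<phi> where "\<phi> t = f (x + t *\<^sub>R h) - t * (G x \<bullet> h) - t\<^sup>2 / 2 * (h \<bullet> L h)" for t
    have lt: "norm (t *\<^sub>R h) < min d r'" if "0 \<le> t" "t \<le> 1" for t
      using that h mult_left_le_one_le[of "norm h" t] by simp
    have der: "(\<phi> has_derivative (\<lambda>s. s * ((G (x + t *\<^sub>R h) - G x - L (t *\<^sub>R h)) \<bullet> h))) (at t)"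
      if "0 \<le> t" "t \<le> 1" for t
    proof -
      have "x + t *\<^sub>R h \<in> N"
        using lt[OF that] r' by (auto simp: subset_iff dist_norm)
      then have "((\<lambda>t. f (x + t *\<^sub>R h)) has_derivative (\<lambda>s. G (x + t *\<^sub>R h) \<bullet> (s *\<^sub>R h))) (at t)"
        by (intro has_derivative_compose[where g=f, OF _ f]) (auto intro!: derivative_eq_intros)
      then show ?thesis
        unfolding \<phi>_def
        by (auto intro!: derivative_eq_intros ext
            simp: algebra_simps inner_diff_left linear_cmul[OF bounded_linear.linear[OF L]] inner_commute)
    qed
    have "\<exists>t\<in>{0<..<1}. \<phi> 1 - \<phi> 0 = (1 - 0) * ((G (x + t *\<^sub>R h) - G x - L (t *\<^sub>R h)) \<bullet> h)"
      using mvt_simple[of 0 1 \<phi> "\<lambda>t s. s * ((G (x + t *\<^sub>R h) - G x - L (t *\<^sub>R h)) \<bullet> h)"]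
        der has_derivative_at_withinI zero_less_one by (metis atLeastAtMost_iff)
    then obtain t where t: "0 < t" "t < 1"
      and eq: "\<phi> 1 - \<phi> 0 = (G (x + t *\<^sub>R h) - G x - L (t *\<^sub>R h)) \<bullet> h" by auto
    have "\<bar>\<phi> 1 - \<phi> 0\<bar> \<le> norm (G (x + t *\<^sub>R h) - G x - L (t *\<^sub>R h)) * norm h"
      unfolding eq by (rule Cauchy_Schwarz_ineq2)
    also have "\<dots> \<le> (\<eta> * norm (t *\<^sub>R h)) * norm h"
      using dG[of "x + t *\<^sub>R h"] lt[of t] t by (intro mult_right_mono) auto
    also have "\<dots> = t * (\<eta> * (norm h)\<^sup>2)"
      using t by (simp add: power2_eq_square)
    also have "\<dots> \<le> \<eta> * (norm h)\<^sup>2"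
      using t \<open>\<eta> > 0\<close> by (intro mult_left_le_one_le) auto
    finally show "\<bar>f (x + h) - f x - G x \<bullet> h - (h \<bullet> L h) / 2\<bar> \<le> \<eta> * (norm h)\<^sup>2"
      by (simp add: \<phi>_def algebra_simps)
  qed (use d r' in auto)
qed

text \<open>The viscosity subsolution property of \<open>\<Delta>\<^sub>\<infinity> w \<ge> 0\<close>, restricted to quadratic test functions: unlike cones and
  the barrier, these are \<open>C\<^sup>2\<close> on the whole domain, as the definitions demand.\<close>

definition jet_subharmonic :: "pt set \<Rightarrow> (pt \<Rightarrow> real) \<Rightarrow> bool" where
  "jet_subharmonic D w \<longleftrightarrow>
     (\<forall>x\<in>D. \<forall>g A. (\<exists>r>0. \<forall>h. norm h < r \<longrightarrow> w (x + h) \<le> w x + g \<bullet> h + (h \<bullet> (A *v h)) / 2)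
        \<longrightarrow> 0 \<le> g \<bullet> (A *v g))"

lemma jet_subharmonic_subset: "jet_subharmonic E w \<Longrightarrow> D \<subseteq> E \<Longrightarrow> jet_subharmonic D w"
  unfolding jet_subharmonic_def by blast

text \<open>At an interior maximum of \<open>w - f\<close> the expansion of \<open>f\<close> gives a
  quadratic touching \<open>w\<close> from above; strictness absorbs the expansion error and
  contradicts subharmonicity, so the maximum lies on the frontier.\<close>

lemma strict_comparison:
  fixes w f :: "pt \<Rightarrow> real"
  assumes "open D" "bounded D" and cont: "continuous_on (closure D) (\<lambda>x. w x - f x)"
    and w: "jet_subharmonic D w"
    and f: "\<And>x. x \<in> D \<Longrightarrow> (f has_derivative (\<lambda>h. G x \<bullet> h)) (at x)"
    and G: "\<And>x. x \<in> D \<Longrightarrow> (G has_derivative L x) (at x)"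
    and strict: "\<And>x. x \<in> D \<Longrightarrow> G x \<bullet> L x (G x) < 0"
    and bd: "\<And>x. x \<in> frontier D \<Longrightarrow> w x \<le> f x"
    and "x \<in> D"
  shows "w x \<le> f x"
proof -
  have "compact (closure D)" "closure D \<noteq> {}"
    using \<open>bounded D\<close> \<open>x \<in> D\<close> closure_subset by auto
  then obtain z where z: "z \<in> closure D" and max: "\<And>y. y \<in> closure D \<Longrightarrow> w y - f y \<le> w z - f z"
    using continuous_attains_sup[OF _ _ cont] by blast
  have "z \<notin> D"
  proof
    assume "z \<in> D"
    \<comment> \<open>The correction \<open>2 * \<eta> * (norm (G z))\<^sup>2\<close> is then at
      most half of \<open>- (G z \<bullet> L z (G z))\<close>; the summand 1 keeps the denominator
      positive.\<close>
    define \<eta> where "\<eta> = - (G z \<bullet> L z (G z)) / (4 * ((norm (G z))\<^sup>2 + 1))"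
    have pos: "(norm (G z))\<^sup>2 + 1 > 0" by (simp add: add_nonneg_pos)
    have \<eta>: "\<eta> > 0"
      unfolding \<eta>_def using strict[OF \<open>z \<in> D\<close>] pos by (intro divide_pos_pos) auto
    obtain r where r: "r > 0" and exp: "\<And>h. norm h < r \<Longrightarrow>
        \<bar>f (z + h) - f z - G z \<bullet> h - (h \<bullet> L z h) / 2\<bar> \<le> \<eta> * (norm h)\<^sup>2"
      using second_order_expansion[OF \<open>open D\<close> \<open>z \<in> D\<close> f G[OF \<open>z \<in> D\<close>] \<eta>] by blast
    obtain r' where r': "r' > 0" "ball z r' \<subseteq> D"
      using \<open>open D\<close> \<open>z \<in> D\<close> open_contains_ball by blast
    define A where "A = matrix (L z) + (2 * \<eta>) *\<^sub>R mat 1"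
    have A: "A *v h = L z h + (2 * \<eta>) *\<^sub>R h" for h
    proof -
      have "matrix (L z) *v h = L z h"
        using G[OF \<open>z \<in> D\<close>] by (simp add: has_derivative_bounded_linear bounded_linear.linear matrix_works)
      then show ?thesis
        by (simp add: A_def matrix_vector_mult_add_rdistrib flip: scaleR_matrix_vector_assoc)
    qed
    have "w (z + h) \<le> w z + G z \<bullet> h + (h \<bullet> (A *v h)) / 2" if "norm h < min r r'" for h
    proof -
      have "z + h \<in> D" using that r' by (auto simp: subset_iff dist_norm)
      then have "w (z + h) - f (z + h) \<le> w z - f z" using max closure_subset by blast
      moreover have "f (z + h) - f z - G z \<bullet> h - (h \<bullet> L z h) / 2 \<le> \<eta> * (norm h)\<^sup>2"
        using exp[of h] that by linarith
      ultimately show ?thesis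
        by (simp add: A inner_add_right power2_norm_eq_inner add_divide_distrib)
    qed
    then have "0 \<le> G z \<bullet> (A *v G z)"
      using w \<open>z \<in> D\<close> r r' unfolding jet_subharmonic_def by (metis min_less_iff_conj)
    then have "0 \<le> G z \<bullet> L z (G z) + 2 * \<eta> * (norm (G z))\<^sup>2"
      by (simp add: A inner_add_right power2_norm_eq_inner)
    moreover have "4 * \<eta> * ((norm (G z))\<^sup>2 + 1) = - (G z \<bullet> L z (G z))"
    proof -
      have "4 * ((norm (G z))\<^sup>2 + 1) \<noteq> 0" using pos by (metis less_irrefl mult_pos_pos zero_less_numeral)
      then show ?thesis unfolding \<eta>_def by (simp add: divide_simps)
    qed
    ultimately show False
      using \<eta> strict[OF \<open>z \<in> D\<close>] by (simp add: algebra_simps)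
  qed
  with z have "z \<in> frontier D"
    using \<open>open D\<close> by (simp add: frontier_def interior_open)
  then show ?thesis
    using bd[of z] max[of x] \<open>x \<in> D\<close> closure_subset by fastforce
qed

lemma has_derivative_norm_diff:
  fixes x z :: "'a::real_inner"
  assumes "x \<noteq> z"
  shows "((\<lambda>x. norm (x - z)) has_derivative (\<lambda>h. ((x - z) \<bullet> h) / norm (x - z))) (at x)"
  by (rule has_derivative_compose[where g=norm and f="\<lambda>x. x - z", THEN has_derivative_eq_rhs, OF _ has_derivative_norm])
    (use assms in \<open>auto intro!: derivative_eq_intros simp: sgn_div_norm divide_inverse inner_commute\<close>)

text \<open>A cone is infinity-harmonic off its vertex, but not strictly superharmonic. Adding
  \<open>\<kappa>\<close> times \<open>2 * K * r - r\<^sup>2\<close>, where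
  \<open>r = norm (y - z) < K\<close>, makes the profile strictly concave and strictly increasing,
  hence strictly superharmonic, and only raises it.\<close>

lemma cone_comparison:
  fixes w :: "pt \<Rightarrow> real"
  assumes "open D" "bounded D" "continuous_on (closure D) w"
    and w: "jet_subharmonic D w" and "z \<notin> D" "B \<ge> 0"
    and bd: "\<And>x. x \<in> frontier D \<Longrightarrow> w x \<le> A + B * norm (x - z)"
    and x: "x \<in> D"
  shows "w x \<le> A + B * norm (x - z)"
proof (rule ccontr)
  assume neg: "\<not> ?thesis"
  have "bounded (closure D)" using \<open>bounded D\<close> by (rule bounded_closure)
  then obtain K0 where "\<And>y. y \<in> closure D \<Longrightarrow> norm y \<le> K0" unfolding bounded_iff by blast
  then have "norm (y - z) < K0 + norm z + 1" if "y \<in> closure D" for y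
    using norm_triangle_ineq4[of y z] that by force
  then obtain K where K: "\<And>y. y \<in> closure D \<Longrightarrow> norm (y - z) < K" by blast
  have Kx: "norm (x - z) < K" "0 < norm (x - z)"
    using K x closure_subset \<open>z \<notin> D\<close> by (auto simp: subset_iff)
  define c where "c = 2 * K * norm (x - z) - (norm (x - z))\<^sup>2"
  have c: "c > 0"
  proof -
    have "c = (2 * K - norm (x - z)) * norm (x - z)"
      by (simp add: c_def power2_eq_square algebra_simps)
    moreover have "2 * K - norm (x - z) > 0" using Kx by linarith
    ultimately show ?thesis using mult_pos_pos Kx(2) by metis
  qed
  \<comment> \<open>\<open>c\<close> is the unscaled perturbation at \<open>x\<close>; with this
    \<open>\<kappa>\<close> it makes up only half of the assumed excess.\<close>
  define \<kappa> where "\<kappa> = (w x - A - B * norm (x - z)) / (2 * c)"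
  have \<kappa>: "\<kappa> > 0" using neg c by (simp add: \<kappa>_def)
  define \<gamma> where "\<gamma> y = (B + 2 * \<kappa> * K) / norm (y - z) - 2 * \<kappa>" for y
  have "w x \<le> A + (B + 2 * \<kappa> * K) * norm (x - z) - \<kappa> * (norm (x - z))\<^sup>2"
  proof (rule strict_comparison[where D=D and f="\<lambda>y. A + (B + 2 * \<kappa> * K) * norm (y - z) - \<kappa> * (norm (y - z))\<^sup>2"
        and G="\<lambda>y. \<gamma> y *\<^sub>R (y - z)"
        and L="\<lambda>y h. (- (B + 2 * \<kappa> * K) * ((y - z) \<bullet> h) / norm (y - z) ^ 3) *\<^sub>R (y - z) + \<gamma> y *\<^sub>R h"])
    fix y assume y: "y \<in> D"
    then have n0: "norm (y - z) > 0" "y \<noteq> z" and nK: "norm (y - z) < K"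
      using \<open>z \<notin> D\<close> K closure_subset by (auto simp: subset_iff)
    note dn = has_derivative_norm_diff[OF n0(2)] and nz = less_imp_neq[OF n0(1), symmetric]
    show "((\<lambda>y. A + (B + 2 * \<kappa> * K) * norm (y - z) - \<kappa> * (norm (y - z))\<^sup>2)
       has_derivative (\<lambda>h. (\<gamma> y *\<^sub>R (y - z)) \<bullet> h)) (at y)"
      unfolding inner_scaleR_left
      by (rule dn derivative_eq_intros refl)+
        (rule ext, use n0 in \<open>simp add: \<gamma>_def divide_simps\<close>, simp add: algebra_simps)
    show "((\<lambda>y. \<gamma> y *\<^sub>R (y - z)) has_derivative
       (\<lambda>h. (- (B + 2 * \<kappa> * K) * ((y - z) \<bullet> h) / norm (y - z) ^ 3) *\<^sub>R (y - z) + \<gamma> y *\<^sub>R h)) (at y)"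
      unfolding \<gamma>_def
      by (rule nz dn derivative_eq_intros refl)+
        (rule ext, use n0 in \<open>simp add: divide_simps eval_nat_numeral\<close>)
    have "B + 2 * \<kappa> * K > 2 * \<kappa> * norm (y - z)"
      using mult_strict_left_mono[OF nK, of "2 * \<kappa>"] \<kappa> \<open>B \<ge> 0\<close> by linarith
    then have "\<gamma> y > 0" using n0 by (simp add: \<gamma>_def field_simps)
    \<comment> \<open>For a radial function this is the squared slope times the second radial
      derivative, here \<open>- 2 * \<kappa>\<close>.\<close>
    have "(\<gamma> y *\<^sub>R (y - z)) \<bullet> ((- (B + 2 * \<kappa> * K) * ((y - z) \<bullet> (\<gamma> y *\<^sub>R (y - z))) / norm (y - z) ^ 3) *\<^sub>R (y - z)
        + \<gamma> y *\<^sub>R (\<gamma> y *\<^sub>R (y - z))) = - 2 * \<kappa> * (\<gamma> y)\<^sup>2 * (norm (y - z))\<^sup>2"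
      (is "?l = _")
    proof -
      have "?l = (\<gamma> y)\<^sup>2 * (norm (y - z))\<^sup>2 * (\<gamma> y - (B + 2 * \<kappa> * K) / norm (y - z))"
        unfolding inner_add_right inner_scaleR_right inner_scaleR_left power2_norm_eq_inner[symmetric]
        using n0 by (simp add: divide_simps) (simp add: algebra_simps eval_nat_numeral)
      then show ?thesis by (simp add: \<gamma>_def)
    qed
    then show "(\<gamma> y *\<^sub>R (y - z)) \<bullet> ((- (B + 2 * \<kappa> * K) * ((y - z) \<bullet> (\<gamma> y *\<^sub>R (y - z))) / norm (y - z) ^ 3) *\<^sub>R (y - z)
        + \<gamma> y *\<^sub>R (\<gamma> y *\<^sub>R (y - z))) < 0"
      using \<open>\<gamma> y > 0\<close> \<kappa> n0 by simp
  next
    fix y assume y: "y \<in> frontier D"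
    then have "norm (y - z) < K" using K by (simp add: frontier_def)
    then have "norm (y - z) * norm (y - z) \<le> 2 * K * norm (y - z)"
    proof (intro mult_right_mono)
      show "norm (y - z) \<le> 2 * K"
        using \<open>norm (y - z) < K\<close> norm_ge_zero[of "y - z"] by linarith
    qed simp
    then have "0 \<le> \<kappa> * (2 * K * norm (y - z) - (norm (y - z))\<^sup>2)"
      using \<kappa> by (simp add: power2_eq_square)
    then show "w y \<le> A + (B + 2 * \<kappa> * K) * norm (y - z) - \<kappa> * (norm (y - z))\<^sup>2"
      using bd[OF y] by (simp add: algebra_simps)
  qed (use assms in \<open>auto intro!: continuous_intros\<close>)
  then have "w x - A - B * norm (x - z) \<le> \<kappa> * c"
    by (simp add: c_def algebra_simps)
  also have "\<dots> = (w x - A - B * norm (x - z)) / 2"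
    using c by (simp add: \<kappa>_def)
  finally show False using neg by simp
qed

section \<open>The barrier\<close>

text \<open>In polar coordinates around \<open>z\<close>, with \<open>s = sqrt r\<close> and \<open>m = cos \<theta> - c\<close>: the gradient of the barrier is
  \<open>fr\<close> times the radial unit vector plus \<open>fX\<close> times \<open>u\<close>, \<open>p\<close> and \<open>q\<close> are its components along these two
  vectors, and the left-hand side is the second derivative in the gradient direction.\<close>

lemma barrier_second_derivative:
  fixes s m c a l :: real
  defines "fr \<equiv> - l - a * s * m\<^sup>2 / 2 - 2 * a * c * s * m"
    and "fX \<equiv> 2 * a * s * m" and "\<mu> \<equiv> m + c"
  defines "p \<equiv> fr + fX * \<mu>" and "q \<equiv> fr * \<mu> + fX"
  defines "\<sigma> \<equiv> p / (2 * s)" and "\<zeta> \<equiv> q - c * p" and "\<xi> \<equiv> s\<^sup>2 * m"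
  assumes s: "s > 0"
  shows "(2 * l * \<sigma> / s ^ 3 - a * \<xi> * \<zeta> / s ^ 5 + 5 * a * \<xi>\<^sup>2 * \<sigma> / (2 * s ^ 6)
            - 2 * a * c * \<zeta> / s ^ 3 + 6 * a * c * \<xi> * \<sigma> / s ^ 4) * (s\<^sup>2 * p)
          + fr / s\<^sup>2 * (fr * p + fX * q)
          + (2 * a * \<zeta> / s - 2 * a * \<xi> * \<sigma> / s\<^sup>2) * q
        = a / s * (2 * (\<zeta> - m * p / 2)\<^sup>2 + m\<^sup>2 * p\<^sup>2 / 4) + 4 * a\<^sup>2 * m\<^sup>2 * fr * (1 - \<mu>\<^sup>2)"
proof -
  \<comment> \<open>With \<open>a\<close> and \<open>s\<close> merged into \<open>t\<close>, all
    terms multiplied by \<open>s\<^sup>2\<close> become polynomial; \<open>l\<close> is eliminated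
    in favour of \<open>fr\<close>.\<close>
  define t where "t = a * s"
  have l: "l = - fr - t * m\<^sup>2 / 2 - 2 * t * c * m" by (simp add: fr_def t_def)
  have fX: "fX = 2 * t * m" by (simp add: fX_def t_def)
  have "(2 * l * \<sigma> / s ^ 3 - a * \<xi> * \<zeta> / s ^ 5 + 5 * a * \<xi>\<^sup>2 * \<sigma> / (2 * s ^ 6)
            - 2 * a * c * \<zeta> / s ^ 3 + 6 * a * c * \<xi> * \<sigma> / s ^ 4) * (s\<^sup>2 * p)
      = (p * (l * p - t * m * \<zeta> + 5 / 4 * t * m\<^sup>2 * p - 2 * t * c * \<zeta> + 3 * t * c * m * p)) / s\<^sup>2"
    unfolding \<sigma>_def \<xi>_def t_def using s by (simp add: divide_simps) (simp add: algebra_simps eval_nat_numeral)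
  moreover have "(2 * a * \<zeta> / s - 2 * a * \<xi> * \<sigma> / s\<^sup>2) * q = (t * (2 * \<zeta> - m * p) * q) / s\<^sup>2"
    unfolding \<sigma>_def \<xi>_def t_def using s by (simp add: divide_simps) (simp add: algebra_simps eval_nat_numeral)
  moreover have "a / s * (2 * (\<zeta> - m * p / 2)\<^sup>2 + m\<^sup>2 * p\<^sup>2 / 4) + 4 * a\<^sup>2 * m\<^sup>2 * fr * (1 - \<mu>\<^sup>2)
      = (t * (2 * (\<zeta> - m * p / 2)\<^sup>2 + m\<^sup>2 * p\<^sup>2 / 4) + fX\<^sup>2 * fr * (1 - \<mu>\<^sup>2)) / s\<^sup>2"
    unfolding fX t_def using s by (simp add: add_divide_distrib power2_eq_square)
  moreover have "p * (l * p - t * m * \<zeta> + 5 / 4 * t * m\<^sup>2 * p - 2 * t * c * \<zeta> + 3 * t * c * m * p)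
      + fr * (fr * p + fX * q) + t * (2 * \<zeta> - m * p) * q
      = t * (2 * (\<zeta> - m * p / 2)\<^sup>2 + m\<^sup>2 * p\<^sup>2 / 4) + fX\<^sup>2 * fr * (1 - \<mu>\<^sup>2)"
  proof -
    have q: "q = \<zeta> + c * p" by (simp add: \<zeta>_def)
    \<comment> \<open>Rests on \<open>fr - p = - (fX * \<mu>)\<close> and
      \<open>q - \<mu> * p = fX * (1 - \<mu>\<^sup>2)\<close>.\<close>
    have 1: "fr * (p * (fr - p) + fX * q) = fX\<^sup>2 * fr * (1 - \<mu>\<^sup>2)"
      unfolding q_def p_def by (simp add: algebra_simps power2_eq_square)
    \<comment> \<open>Completing the square in \<open>\<zeta>\<close>; the leftover
      \<open>m\<^sup>2 * p\<^sup>2 / 4\<close> is the positive term that drives the barrier.\<close>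
    have 2: "p * (3 / 4 * t * m\<^sup>2 * p + t * c * m * p - t * m * \<zeta> - 2 * t * c * \<zeta>)
        + t * (2 * \<zeta> - m * p) * (\<zeta> + c * p) = t * (2 * (\<zeta> - m * p / 2)\<^sup>2 + m\<^sup>2 * p\<^sup>2 / 4)"
      by (simp add: field_simps power2_eq_square)
    have "p * (l * p - t * m * \<zeta> + 5 / 4 * t * m\<^sup>2 * p - 2 * t * c * \<zeta> + 3 * t * c * m * p)
        = p * (3 / 4 * t * m\<^sup>2 * p + t * c * m * p - t * m * \<zeta> - 2 * t * c * \<zeta>) - fr * p * p"
      unfolding l by (simp add: field_simps)
    then show ?thesis
      unfolding 1[symmetric] 2[symmetric] q[symmetric] by (simp add: algebra_simps)
  qed
  ultimately show ?thesis
    by (simp only: times_divide_eq_left add_divide_distrib[symmetric])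
qed

text \<open>Only the last summand can be negative. It is of order
  \<open>a\<^sup>2 * m\<^sup>2 * l\<close>, while \<open>\<bar>p\<bar> \<ge> l / 2\<close> makes the
  first at least \<open>a * m\<^sup>2 * l\<^sup>2 / (16 * s)\<close>. The common factor
  \<open>m\<^sup>2\<close> makes the comparison uniform up to the edge of the sector.\<close>

lemma barrier_second_derivative_pos:
  fixes s m c a l :: real
  defines "fr \<equiv> - l - a * s * m\<^sup>2 / 2 - 2 * a * c * s * m"
    and "fX \<equiv> 2 * a * s * m" and "\<mu> \<equiv> m + c"
  defines "p \<equiv> fr + fX * \<mu>" and "q \<equiv> fr * \<mu> + fX"
  assumes s: "s > 0" and a: "a > 0" and small: "128 * (a * s) < l"
    and m: "m > 0" and c: "c > 0" and \<mu>: "\<mu> \<le> 1"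
  shows "0 < a / s * (2 * (q - c * p - m * p / 2)\<^sup>2 + m\<^sup>2 * p\<^sup>2 / 4) + 4 * a\<^sup>2 * m\<^sup>2 * fr * (1 - \<mu>\<^sup>2)"
proof -
  define t where "t = a * s"
  have t: "t > 0" "128 * t < l" using a s small by (auto simp: t_def)
  have m1: "m \<le> 1" "c \<le> 1" using \<mu> c m by (auto simp: \<mu>_def)
  have mm: "t * m\<^sup>2 \<le> t" and cm: "t * (c * m) \<le> t"
    using t m c m1 by (auto intro!: mult_left_le simp: power_le_one mult_le_one)
  have tm: "0 \<le> t * m\<^sup>2" "0 \<le> t * (c * m)" using t m c by auto
  \<comment> \<open>\<open>p\<close> is the derivative of
    \<open>1 - l * r + a * r powr (3/2) * m\<^sup>2\<close> in \<open>r\<close> for fixed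
    \<open>m\<close>, at \<open>r = s\<^sup>2\<close>.\<close>
  have "p = - l + 3 / 2 * (t * m\<^sup>2)"
    by (simp add: p_def fr_def fX_def \<mu>_def t_def power2_eq_square algebra_simps)
  then have "l / 2 \<le> - p" using mm t by linarith
  then have "(l / 2)\<^sup>2 \<le> (- p)\<^sup>2" using t by (intro power_mono) auto
  then have p2: "l\<^sup>2 / 4 \<le> p\<^sup>2" by (simp add: power_divide)
  have "fr = - l - (t * m\<^sup>2) / 2 - 2 * (t * (c * m))" by (simp add: fr_def t_def)
  then have fr: "- fr \<le> 2 * l" "0 \<le> - fr" using mm cm tm t by linarith+
  have \<mu>2: "0 \<le> 1 - \<mu>\<^sup>2" "1 - \<mu>\<^sup>2 \<le> 1" using \<mu> m c by (auto simp: \<mu>_def power_le_one)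
  have "(- fr) * (1 - \<mu>\<^sup>2) \<le> 2 * l"
    using mult_left_le[OF \<mu>2(2) fr(2)] fr(1) by linarith
  then have "4 * t * ((- fr) * (1 - \<mu>\<^sup>2)) \<le> 4 * t * (2 * l)"
    using t by (intro mult_left_mono) auto
  also have "\<dots> < l\<^sup>2 / 16"
    using t mult_strict_right_mono[of "128 * t" l l] by (simp add: power2_eq_square)
  also have "\<dots> \<le> p\<^sup>2 / 4" using p2 by simp
  finally have main: "0 < p\<^sup>2 / 4 + 4 * t * fr * (1 - \<mu>\<^sup>2)" by simp
  have "0 < (a / s * m\<^sup>2) * (p\<^sup>2 / 4 + 4 * t * fr * (1 - \<mu>\<^sup>2))"
    using main a s m by simp
  also have "\<dots> = a / s * (m\<^sup>2 * p\<^sup>2 / 4) + 4 * a\<^sup>2 * m\<^sup>2 * fr * (1 - \<mu>\<^sup>2)"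
    using s by (simp add: t_def power2_eq_square field_simps)
  also have "\<dots> \<le> a / s * (2 * (q - c * p - m * p / 2)\<^sup>2 + m\<^sup>2 * p\<^sup>2 / 4) + 4 * a\<^sup>2 * m\<^sup>2 * fr * (1 - \<mu>\<^sup>2)"
    using a s by (intro add_right_mono mult_left_mono) auto
  finally show ?thesis .
qed

text \<open>The last term is \<open>a * r powr (3/2) * (cos \<theta> - c)\<^sup>2\<close> for a unit
  vector \<open>u\<close>. At \<open>x = z\<close> the quotient \<open>0 / 0\<close> counts as 0, so
  the value is 1.\<close>

definition barrier :: "pt \<Rightarrow> pt \<Rightarrow> real \<Rightarrow> real \<Rightarrow> real \<Rightarrow> pt \<Rightarrow> real" where
  "barrier z u l a c x = 1 - l * norm (x - z)
     + a * (u \<bullet> (x - z) - c * norm (x - z))\<^sup>2 / sqrt (norm (x - z))"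

text \<open>For \<open>S = sqrt r\<close> and \<open>X = r * (cos \<theta> - c)\<close> the second
  function is the barrier, the first and third are the coefficients of \<open>x - z\<close> and
  \<open>u\<close> in its gradient. Abstract \<open>S\<close> and \<open>X\<close> keep the calculus
  rational.\<close>

lemma barrier_profile_derivatives:
  fixes S X :: "pt \<Rightarrow> real"
  assumes dS: "(S has_derivative S') (at x)" and dX: "(X has_derivative X') (at x)" and S0: "S x > 0"
  shows "((\<lambda>x. - l / (S x)\<^sup>2 - a * (X x)\<^sup>2 / (2 * S x ^ 5) - 2 * a * c * X x / S x ^ 3) has_derivative
           (\<lambda>h. 2 * l * S' h / S x ^ 3 - a * X x * X' h / S x ^ 5
             + 5 * a * (X x)\<^sup>2 * S' h / (2 * S x ^ 6)
             - 2 * a * c * X' h / S x ^ 3 + 6 * a * c * X x * S' h / S x ^ 4)) (at x)"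
    and "((\<lambda>x. 1 - l * (S x)\<^sup>2 + a * (X x)\<^sup>2 / S x) has_derivative
           (\<lambda>h. - 2 * l * S x * S' h + 2 * a * X x * X' h / S x - a * (X x)\<^sup>2 * S' h / (S x)\<^sup>2)) (at x)"
    and "((\<lambda>x. 2 * a * X x / S x) has_derivative
           (\<lambda>h. 2 * a * X' h / S x - 2 * a * X x * S' h / (S x)\<^sup>2)) (at x)"
proof -
  have nz: "S x \<noteq> 0" "(S x)\<^sup>2 \<noteq> 0" "2 * S x ^ 5 \<noteq> 0" "S x ^ 3 \<noteq> 0" using S0 by auto
  show "((\<lambda>x. - l / (S x)\<^sup>2 - a * (X x)\<^sup>2 / (2 * S x ^ 5) - 2 * a * c * X x / S x ^ 3) has_derivative
           (\<lambda>h. 2 * l * S' h / S x ^ 3 - a * X x * X' h / S x ^ 5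
             + 5 * a * (X x)\<^sup>2 * S' h / (2 * S x ^ 6)
             - 2 * a * c * X' h / S x ^ 3 + 6 * a * c * X x * S' h / S x ^ 4)) (at x)"
    by (rule nz dS dX derivative_eq_intros refl)+
      (rule ext, use S0 in \<open>simp add: divide_simps\<close>, simp add: algebra_simps eval_nat_numeral)
  show "((\<lambda>x. 1 - l * (S x)\<^sup>2 + a * (X x)\<^sup>2 / S x) has_derivative
           (\<lambda>h. - 2 * l * S x * S' h + 2 * a * X x * X' h / S x - a * (X x)\<^sup>2 * S' h / (S x)\<^sup>2)) (at x)"
    by (rule nz dS dX derivative_eq_intros refl)+
      (rule ext, use S0 in \<open>simp add: divide_simps\<close>, simp add: algebra_simps eval_nat_numeral)
  show "((\<lambda>x. 2 * a * X x / S x) has_derivative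
           (\<lambda>h. 2 * a * X' h / S x - 2 * a * X x * S' h / (S x)\<^sup>2)) (at x)"
    by (rule nz dS dX derivative_eq_intros refl)+
      (rule ext, use S0 in \<open>simp add: divide_simps\<close>, simp add: algebra_simps eval_nat_numeral)
qed

text \<open>Strict subharmonicity in the sector reduces to
  \<open>barrier_second_derivative_pos\<close>, whose smallness condition follows from
  \<open>small\<close> for all \<open>s \<le> sqrt R\<close>.\<close>

lemma barrier_derivatives:
  fixes z u :: pt and l a c R :: real
  assumes u: "norm u = 1" and a: "a > 0" and c: "c > 0"
    and small: "128 * (a * sqrt R) < l"
  obtains G L where
    "\<And>x. \<lbrakk>norm (x - z) \<le> R; c * norm (x - z) < u \<bullet> (x - z)\<rbrakk> \<Longrightarrow>
       (barrier z u l a c has_derivative (\<lambda>h. G x \<bullet> h)) (at x)"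
    "\<And>x. \<lbrakk>norm (x - z) \<le> R; c * norm (x - z) < u \<bullet> (x - z)\<rbrakk> \<Longrightarrow> (G has_derivative L x) (at x)"
    "\<And>x. \<lbrakk>norm (x - z) \<le> R; c * norm (x - z) < u \<bullet> (x - z)\<rbrakk> \<Longrightarrow> 0 < G x \<bullet> L x (G x)"
proof -
  define S where "S x = sqrt (norm (x - z))" for x
  define \<xi> where "\<xi> x = u \<bullet> (x - z) - c * (S x)\<^sup>2" for x
  define \<alpha> where "\<alpha> x = - l / (S x)\<^sup>2 - a * (\<xi> x)\<^sup>2 / (2 * S x ^ 5) - 2 * a * c * \<xi> x / S x ^ 3" for x
  define \<beta> where "\<beta> x = 2 * a * \<xi> x / S x" for x
  define S' where "S' x h = ((x - z) \<bullet> h) / (2 * S x ^ 3)" for x h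
  define \<xi>' where "\<xi>' x h = u \<bullet> h - 2 * c * S x * S' x h" for x h
  define \<alpha>' where "\<alpha>' x h = 2 * l * S' x h / S x ^ 3 - a * \<xi> x * \<xi>' x h / S x ^ 5
      + 5 * a * (\<xi> x)\<^sup>2 * S' x h / (2 * S x ^ 6)
      - 2 * a * c * \<xi>' x h / S x ^ 3 + 6 * a * c * \<xi> x * S' x h / S x ^ 4" for x h
  define \<beta>' where "\<beta>' x h = 2 * a * \<xi>' x h / S x - 2 * a * \<xi> x * S' x h / (S x)\<^sup>2" for x h
  define G where "G x = \<alpha> x *\<^sub>R (x - z) + \<beta> x *\<^sub>R u" for x
  define L where "L x h = \<alpha>' x h *\<^sub>R (x - z) + \<alpha> x *\<^sub>R h + \<beta>' x h *\<^sub>R u" for x h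
  have bar: "barrier z u l a c = (\<lambda>x. 1 - l * (S x)\<^sup>2 + a * (\<xi> x)\<^sup>2 / S x)"
    by (auto simp: barrier_def S_def \<xi>_def)
  {
    fix x assume x: "norm (x - z) \<le> R" "c * norm (x - z) < u \<bullet> (x - z)"
    have xz: "x \<noteq> z" using x by auto
    then have S0: "S x > 0" by (simp add: S_def)
    have S2: "(S x)\<^sup>2 = norm (x - z)" by (simp add: S_def)
    then have S4: "(S x) ^ 4 = (x - z) \<bullet> (x - z)"
      by (metis mult_2 numeral_Bit0 power2_norm_eq_inner power_add power2_eq_square)
    note dn = has_derivative_norm_diff[OF xz]
    have dS: "(S has_derivative S' x) (at x)"
    proof -
      have n0: "norm (x - z) > 0" using xz by simp
      have "(S has_derivative (\<lambda>h. ((x - z) \<bullet> h) / norm (x - z) / (2 * sqrt (norm (x - z))))) (at x)"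
        unfolding S_def
        by (rule n0 dn derivative_eq_intros refl)+ (rule ext, use n0 in \<open>simp add: divide_simps\<close>)
      moreover have "((x - z) \<bullet> h) / norm (x - z) / (2 * sqrt (norm (x - z))) = S' x h" for h
        unfolding S'_def S2[symmetric] using S0 by (simp add: S_def[symmetric] eval_nat_numeral)
      ultimately show ?thesis by simp
    qed
    have d\<xi>: "(\<xi> has_derivative \<xi>' x) (at x)"
      unfolding \<xi>_def
      by (rule dS derivative_eq_intros refl)+ (rule ext, simp add: \<xi>'_def)
    have d\<alpha>: "(\<alpha> has_derivative \<alpha>' x) (at x)"
      unfolding \<alpha>_def \<alpha>'_def by (rule barrier_profile_derivatives(1)[OF dS d\<xi> S0])
    have d\<beta>: "(\<beta> has_derivative \<beta>' x) (at x)"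
      unfolding \<beta>_def \<beta>'_def by (rule barrier_profile_derivatives(3)[OF dS d\<xi> S0])
    have "(barrier z u l a c has_derivative (\<lambda>h. G x \<bullet> h)) (at x)"
    proof -
      have "- 2 * l * S x * S' x h + 2 * a * \<xi> x * \<xi>' x h / S x - a * (\<xi> x)\<^sup>2 * S' x h / (S x)\<^sup>2 = G x \<bullet> h" for h
        unfolding G_def \<alpha>_def \<beta>_def \<xi>'_def S'_def inner_add_left inner_scaleR_left
        using S0 by (simp add: divide_simps) (simp add: algebra_simps eval_nat_numeral)
      then show ?thesis
        unfolding bar using barrier_profile_derivatives(2)[OF dS d\<xi> S0, of l a] by simp
    qed
    moreover have "(G has_derivative L x) (at x)"
      unfolding G_def
      by (rule d\<alpha> d\<beta> derivative_eq_intros refl)+ (rule ext, simp add: L_def algebra_simps)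
    moreover have "0 < G x \<bullet> L x (G x)"
    proof -
      \<comment> \<open>Translation to the algebraic variables: \<open>s\<close> is the root of the
        distance, \<open>\<mu>\<close> the cosine of the angle to the axis \<open>u\<close>.\<close>
      define s where "s = S x"
      define m where "m = \<xi> x / s\<^sup>2"
      define fr where "fr = - l - a * s * m\<^sup>2 / 2 - 2 * a * c * s * m"
      define fX where "fX = 2 * a * s * m"
      define \<mu> where "\<mu> = m + c"
      define p where "p = fr + fX * \<mu>"
      define q where "q = fr * \<mu> + fX"
      have s: "s > 0" "s \<le> sqrt R" using S0 x by (auto simp: s_def S_def)
      have \<xi>: "\<xi> x = s\<^sup>2 * m" using s by (simp add: m_def)
      have "\<xi> x > 0" using x S2 by (simp add: \<xi>_def)
      then have m: "m > 0" using s by (simp add: m_def)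
      have ux: "u \<bullet> (x - z) = s\<^sup>2 * \<mu>"
        using \<xi> by (simp add: \<xi>_def \<mu>_def s_def algebra_simps)
      have "s\<^sup>2 * \<mu> \<le> s\<^sup>2 * 1"
        using norm_cauchy_schwarz[of u "x - z"] u S2 ux by (simp add: s_def)
      then have \<mu>: "\<mu> \<le> 1" using s mult_le_cancel_left_pos[of "s\<^sup>2" \<mu> 1] by simp
      have small': "128 * (a * s) < l"
        using mult_left_mono[OF s(2), of a] a small by linarith
      have \<alpha>: "\<alpha> x = fr / s\<^sup>2"
        unfolding \<alpha>_def \<xi> s_def[symmetric] fr_def using s by (simp add: field_simps eval_nat_numeral)
      have \<beta>: "\<beta> x = fX"
        unfolding \<beta>_def \<xi> s_def[symmetric] fX_def using s by (simp add: field_simps eval_nat_numeral)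
      have uu: "u \<bullet> u = 1" using u by (simp add: norm_eq_1)
      have yg: "(x - z) \<bullet> G x = s\<^sup>2 * p"
        unfolding G_def inner_add_right inner_scaleR_right S4[symmetric] inner_commute[of _ u] ux \<alpha> \<beta> p_def
        using s by (simp add: s_def field_simps eval_nat_numeral)
      have ug: "u \<bullet> G x = q"
        unfolding G_def inner_add_right inner_scaleR_right ux uu \<alpha> \<beta> q_def using s by simp
      have gg: "G x \<bullet> G x = fr * p + fX * q"
        by (subst G_def) (use s in \<open>simp add: inner_add_left yg ug \<alpha> \<beta>\<close>)
      have \<sigma>: "S' x (G x) = p / (2 * s)"
        using s by (simp add: S'_def yg s_def[symmetric] field_simps eval_nat_numeral)
      have \<zeta>: "\<xi>' x (G x) = q - c * p"
        using s by (simp add: \<xi>'_def ug \<sigma> s_def[symmetric])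
      have "G x \<bullet> L x (G x) = \<alpha>' x (G x) * (s\<^sup>2 * p) + fr / s\<^sup>2 * (fr * p + fX * q) + \<beta>' x (G x) * q"
        unfolding L_def inner_add_right inner_scaleR_right gg \<alpha>
        by (simp add: inner_commute[of "G x"] yg ug)
      also have "\<dots> = a / s * (2 * (q - c * p - m * p / 2)\<^sup>2 + m\<^sup>2 * p\<^sup>2 / 4) + 4 * a\<^sup>2 * m\<^sup>2 * fr * (1 - \<mu>\<^sup>2)"
        unfolding \<alpha>'_def \<beta>'_def \<sigma> \<zeta> \<xi> s_def[symmetric]
        using barrier_second_derivative[OF s(1), of l a m c]
        unfolding fr_def[symmetric] fX_def[symmetric] \<mu>_def[symmetric] p_def[symmetric] q_def[symmetric] .
      also have "\<dots> > 0"
        using barrier_second_derivative_pos[OF s(1) a small' m c] \<mu>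
        unfolding fr_def[symmetric] fX_def[symmetric] \<mu>_def[symmetric] p_def[symmetric] q_def[symmetric] .
      finally show ?thesis .
    qed
    ultimately have "(barrier z u l a c has_derivative (\<lambda>h. G x \<bullet> h)) (at x)"
      "(G has_derivative L x) (at x)" "0 < G x \<bullet> L x (G x)" .
  }
  then show thesis by (rule that)
qed

text \<open>Near \<open>z\<close> the last term is at most a constant times
  \<open>norm (x - z) powr (3/2)\<close>. Continuity there matters because the vertex lies on the
  frontier of the sector used later.\<close>

lemma continuous_on_barrier: "continuous_on UNIV (barrier z u l a c)"
proof -
  have "isCont (barrier z u l a c) x" for x
  proof (cases "x = z")
    case False
    then show ?thesis
      unfolding barrier_def by (auto intro!: continuous_intros)
  next
    case True
    have "\<bar>a * (u \<bullet> (x - z) - c * norm (x - z))\<^sup>2 / sqrt (norm (x - z))\<bar>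
        \<le> \<bar>a\<bar> * (norm u + \<bar>c\<bar>)\<^sup>2 * (sqrt (norm (x - z)) * norm (x - z))" for x
    proof (cases "x = z")
      case False
      define s where "s = sqrt (norm (x - z))"
      have s: "s > 0" "norm (x - z) = s\<^sup>2" using False by (auto simp: s_def)
      have "\<bar>u \<bullet> (x - z) - c * norm (x - z)\<bar> \<le> (norm u + \<bar>c\<bar>) * s\<^sup>2"
        using Cauchy_Schwarz_ineq2[of u "x - z"] abs_triangle_ineq4[of "u \<bullet> (x - z)" "c * norm (x - z)"]
        by (simp add: s abs_mult algebra_simps)
      then have "(u \<bullet> (x - z) - c * norm (x - z))\<^sup>2 \<le> ((norm u + \<bar>c\<bar>) * s\<^sup>2)\<^sup>2"
        by (rule power2_le_iff_abs_le[THEN iffD2, rotated]) auto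
      then have "\<bar>a\<bar> * (u \<bullet> (x - z) - c * norm (x - z))\<^sup>2 / s \<le> \<bar>a\<bar> * ((norm u + \<bar>c\<bar>) * s\<^sup>2)\<^sup>2 / s"
        using s by (intro divide_right_mono mult_left_mono) auto
      also have "\<dots> = \<bar>a\<bar> * (norm u + \<bar>c\<bar>)\<^sup>2 * (s * s\<^sup>2)"
        using s by (simp add: field_simps eval_nat_numeral)
      finally show ?thesis
        unfolding s_def[symmetric] s(2)[symmetric] using s by (simp add: abs_mult)
    qed simp
    then have "\<forall>\<^sub>F x in at z. norm (a * (u \<bullet> (x - z) - c * norm (x - z))\<^sup>2 / sqrt (norm (x - z)))
        \<le> \<bar>a\<bar> * (norm u + \<bar>c\<bar>)\<^sup>2 * (sqrt (norm (x - z)) * norm (x - z))"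
      unfolding real_norm_def by (rule always_eventually[OF allI])
    moreover have "((\<lambda>x. \<bar>a\<bar> * (norm u + \<bar>c\<bar>)\<^sup>2 * (sqrt (norm (x - z)) * norm (x - z))) \<longlongrightarrow> 0) (at z)"
      by (auto intro!: tendsto_eq_intros)
    ultimately have "((\<lambda>x. a * (u \<bullet> (x - z) - c * norm (x - z))\<^sup>2 / sqrt (norm (x - z))) \<longlongrightarrow> 0) (at z)"
      by (rule Lim_null_comparison)
    moreover have "((\<lambda>x. 1 - l * norm (x - z)) \<longlongrightarrow> 1 - l * norm (z - z)) (at z)"
      by (intro tendsto_intros)
    ultimately have "(barrier z u l a c \<longlongrightarrow> 1 - l * norm (z - z) + 0) (at z)"
      unfolding barrier_def by (rule tendsto_add[rotated])
    then show ?thesis using True by (simp add: isCont_def barrier_def)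
  qed
  then show ?thesis by (simp add: continuous_at_imp_continuous_on)
qed

section \<open>Viscosity solutions and quadratic jets\<close>

lemma quadratic_inner_symmetric_part:
  fixes A :: "real^2^2"
  shows "g \<bullet> (((1/2) *\<^sub>R (A + transpose A)) *v g) = g \<bullet> (A *v g)"
  by (simp add: scaleR_matrix_vector_assoc[symmetric] matrix_vector_mult_add_rdistrib inner_add_right
      inner_commute[of g "g v* A"] dot_lmul_matrix)

text \<open>A quadratic is an admissible test function on any \<open>U\<close>, and the infinity
  Laplacian at \<open>x\<close> sees only the symmetric part of \<open>A\<close>.\<close>

lemma visc_inf_harmonic_jet_subharmonic:
  assumes v: "visc_inf_harmonic U v"
  shows "jet_subharmonic U v"
  unfolding jet_subharmonic_def
proof (intro ballI allI impI)
  fix x g and A :: "real^2^2"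
  assume x: "x \<in> U"
  assume "\<exists>r>0. \<forall>h. norm h < r \<longrightarrow> v (x + h) \<le> v x + g \<bullet> h + (h \<bullet> (A *v h)) / 2"
  then obtain r where r: "r > 0"
    and le: "\<And>h. norm h < r \<Longrightarrow> v (x + h) \<le> v x + g \<bullet> h + (h \<bullet> (A *v h)) / 2" by blast
  have "touches_above (\<lambda>y. v x + g \<bullet> (y - x) + ((y - x) \<bullet> (A *v (y - x))) / 2) v x"
    unfolding touches_above_def
  proof (intro conjI exI[of _ r] ballI)
    fix y assume "y \<in> ball x r"
    then show "v y \<le> v x + g \<bullet> (y - x) + ((y - x) \<bullet> (A *v (y - x))) / 2"
      using le[of "y - x"] by (simp add: dist_norm norm_minus_commute)
  qed (use r in auto)
  then have "0 \<le> inf_lap (\<lambda>y. g + ((1/2) *\<^sub>R (A + transpose A)) *v (y - x)) (\<lambda>_. (1/2) *\<^sub>R (A + transpose A)) x"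
    using v x C2_on_quadratic unfolding visc_inf_harmonic_def by blast
  then show "0 \<le> g \<bullet> (A *v g)"
    unfolding inf_lap_def by (simp only: diff_self matrix_vector_mult_0_right add_0_right quadratic_inner_symmetric_part)
qed

text \<open>Touching from below forces the maximum to be at most 0, hence both of its
  entries.\<close>

lemma visc_inf_eigen_eq_lower_jet:
  fixes A :: "real^2^2"
  assumes v: "visc_inf_eigen_eq l U v" and x: "x \<in> U" and r: "r > 0"
    and le: "\<And>h. norm h < r \<Longrightarrow> v x + g \<bullet> h + (h \<bullet> (A *v h)) / 2 \<le> v (x + h)"
  shows "l \<le> norm g / v x" and "g \<bullet> (A *v g) \<le> 0"
proof -
  let ?\<phi> = "\<lambda>y. v x + g \<bullet> (y - x) + ((y - x) \<bullet> (A *v (y - x))) / 2"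
  have "touches_below ?\<phi> v x"
    unfolding touches_below_def
  proof (intro conjI exI[of _ r] ballI)
    fix y assume "y \<in> ball x r"
    then show "?\<phi> y \<le> v y"
      using le[of "y - x"] by (simp add: dist_norm norm_minus_commute)
  qed (use r in auto)
  then have "max (l - norm (g + ((1/2) *\<^sub>R (A + transpose A)) *v (x - x)) / ?\<phi> x)
      (inf_lap (\<lambda>y. g + ((1/2) *\<^sub>R (A + transpose A)) *v (y - x)) (\<lambda>_. (1/2) *\<^sub>R (A + transpose A)) x) \<le> 0"
    using v x C2_on_quadratic unfolding visc_inf_eigen_eq_def by blast
  then show "l \<le> norm g / v x" "g \<bullet> (A *v g) \<le> 0"
    unfolding inf_lap_def
    by (simp_all only: diff_self matrix_vector_mult_0_right add_0_right quadratic_inner_symmetric_part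
        inner_zero_left inner_zero_right) (simp_all)
qed

text \<open>A quadratic above \<open>- v\<close> is minus a quadratic below \<open>v\<close>, and
  the infinity Laplacian is odd.\<close>

lemma visc_inf_eigen_eq_jet_subharmonic_minus:
  assumes v: "visc_inf_eigen_eq l U v"
  shows "jet_subharmonic U (\<lambda>x. - v x)"
  unfolding jet_subharmonic_def
proof (intro ballI allI impI)
  fix x g and A :: "real^2^2"
  assume x: "x \<in> U"
  assume "\<exists>r>0. \<forall>h. norm h < r \<longrightarrow> - v (x + h) \<le> - v x + g \<bullet> h + (h \<bullet> (A *v h)) / 2"
  then obtain r where r: "r > 0"
    and le: "\<And>h. norm h < r \<Longrightarrow> - v (x + h) \<le> - v x + g \<bullet> h + (h \<bullet> (A *v h)) / 2" by blast
  have A: "(- A) *v h = - (A *v h)" for h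
    using scaleR_matrix_vector_assoc[of "-1" A h] scaleR_minus1_left by metis
  have "(- g) \<bullet> ((- A) *v (- g)) \<le> 0"
  proof (rule visc_inf_eigen_eq_lower_jet(2)[OF v x r])
    fix h :: pt assume "norm h < r"
    then show "v x + (- g) \<bullet> h + (h \<bullet> ((- A) *v h)) / 2 \<le> v (x + h)"
      using le[of h] by (simp add: A)
  qed
  then show "0 \<le> g \<bullet> (A *v g)"
    using matrix_vector_mult_diff_distrib[of A 0 g] by (simp add: A)
qed

lemma norm_le_of_cone_bound:
  fixes g :: "'a::real_inner"
  assumes r: "r > 0" and K: "K > 0" and B: "B \<ge> 0"
    and le: "\<And>h. norm h < r \<Longrightarrow> g \<bullet> h - K * (norm h)\<^sup>2 \<le> B * norm h"
  shows "norm g \<le> B"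
proof (rule ccontr)
  assume "\<not> norm g \<le> B"
  then have g: "norm g > B" "norm g > 0" using B by auto
  \<comment> \<open>Testing along \<open>g\<close> at this length, the quadratic error uses up at
    most half of the gap \<open>norm g - B\<close>.\<close>
  define t where "t = min (r / 2) ((norm g - B) / (2 * K))"
  have t: "t > 0" "t < r" "t \<le> (norm g - B) / (2 * K)" using r g K by (auto simp: t_def)
  have Kt: "2 * (K * t) \<le> norm g - B" using t(3) K by (simp add: field_simps)
  define h where "h = (t / norm g) *\<^sub>R g"
  have h: "norm h = t" "g \<bullet> h = t * norm g"
    using g t by (auto simp: h_def power2_norm_eq_inner[symmetric] power2_eq_square)
  have "t * norm g - t * (K * t) \<le> t * B"
    using le[of h] t h by (simp add: power2_eq_square mult_ac)
  then have "t * (norm g - K * t) \<le> t * B" by (simp add: algebra_simps)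
  then have "norm g - K * t \<le> B" using t by simp
  then show False using Kt g by linarith
qed

section \<open>Geometry of the domain\<close>

abbreviation S_center :: pt where "S_center \<equiv> vector [-1, 0]"

text \<open>The bounding line is tangent to the large disk; \<open>n $ 1 \<le> e / 2\<close> says
  that the small disk, shifted by 2 and with radius smaller by \<open>e\<close>, does not stick
  out.\<close>

lemma S_dom_halfplane:
  assumes x: "x \<in> S_dom e" and n: "norm n = 1" "n $ 1 \<le> e / 2"
  shows "n \<bullet> (x - S_center) < 1 + e"
proof -
  have nl: "n \<bullet> d \<le> norm d" for d
    using norm_cauchy_schwarz[of n d] n by simp
  have "S_dom e \<subseteq> {y. n \<bullet> y < 1 + e + n \<bullet> S_center}"
    unfolding S_dom_def
  proof (rule hull_minimal)
    show "ball S_center (1 + e) \<union> ball (vector [1, 0]) 1 \<subseteq> {y. n \<bullet> y < 1 + e + n \<bullet> S_center}"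
    proof safe
      fix y :: pt assume "y \<in> ball S_center (1 + e)"
      then show "n \<bullet> y < 1 + e + n \<bullet> S_center"
        using nl[of "y - S_center"] by (simp add: dist_norm norm_minus_commute inner_diff_right)
    next
      fix y :: pt assume "y \<in> ball (vector [1, 0]) 1"
      moreover have "n \<bullet> vector [1, 0] - n \<bullet> S_center = 2 * n $ 1"
        by (simp add: inner_vec_def sum_2)
      ultimately show "n \<bullet> y < 1 + e + n \<bullet> S_center"
        using nl[of "y - vector [1, 0]"] n(2) by (simp add: dist_norm norm_minus_commute inner_diff_right)
    qed
  qed (rule convex_halfspace_lt)
  then show ?thesis using x by (auto simp: inner_diff_right)
qed

text \<open>Otherwise moving from \<open>x\<close> along \<open>n\<close> onto the bounding line
  would stay inside the ball.\<close>

lemma S_dom_ball_halfplane: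
  assumes x: "x \<in> S_dom e" and b: "ball x d \<subseteq> S_dom e" and n: "norm n = 1" "n $ 1 \<le> e / 2"
  shows "n \<bullet> (x - S_center) + d \<le> 1 + e"
proof (rule ccontr)
  assume neg: "\<not> ?thesis"
  define t where "t = 1 + e - n \<bullet> (x - S_center)"
  have t: "t > 0" "t < d" using S_dom_halfplane[OF x n] neg by (auto simp: t_def)
  then have "x + t *\<^sub>R n \<in> S_dom e" using b n by (auto simp: subset_iff dist_norm)
  from S_dom_halfplane[OF this n] have "n \<bullet> (x - S_center) + t * (n \<bullet> n) < 1 + e"
    by (simp add: inner_diff_right inner_add_right)
  then show False using n by (simp add: t_def norm_eq_1)
qed

lemma S_dom_ball_radius_le:
  assumes "x \<in> S_dom e" "ball x d \<subseteq> S_dom e" "e > 0"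
  shows "d \<le> 1 + e"
  using S_dom_ball_halfplane[OF assms(1,2), of "vector [0, 1]"] S_dom_ball_halfplane[OF assms(1,2), of "vector [0, -1]"] assms(3)
  by (simp add: inner_vec_def sum_2 norm_eq_1)

lemma S_dom_max_ball_center:
  assumes x: "x \<in> S_dom e" "ball x (1 + e) \<subseteq> S_dom e" and e: "0 < e" "e < 1"
  shows "x = S_center"
proof -
  note H = S_dom_ball_halfplane[OF x]
  have "x $ 2 = 0"
    using H[of "vector [0, 1]"] H[of "vector [0, -1]"] e
    by (simp add: inner_vec_def sum_2 norm_eq_1)
  moreover have "x $ 1 \<ge> -1"
    using H[of "vector [-1, 0]"] e by (simp add: inner_vec_def sum_2 norm_eq_1)
  \<comment> \<open>The normal used is that of a common outer tangent of both disks, the extreme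
    case \<open>n $ 1 = e / 2\<close>; its positive first component excludes centres further
    right.\<close>
  moreover have "x $ 1 \<le> -1"
  proof -
    have "(e / 2)\<^sup>2 \<le> 1" using e by (intro power_le_one) auto
    then have "norm (vector [e / 2, sqrt (1 - (e / 2)\<^sup>2)] :: pt) = 1"
      by (simp add: norm_eq_1 inner_vec_def sum_2 power2_eq_square[symmetric])
    from H[OF this] have "e / 2 * (x $ 1 + 1) \<le> 0"
      using \<open>x $ 2 = 0\<close> by (simp add: inner_vec_def sum_2)
    then show ?thesis using e by (simp add: mult_le_0_iff)
  qed
  ultimately show ?thesis by (simp add: vec_eq_iff forall_2)
qed

lemma
  shows open_S_dom: "open (S_dom e)" and convex_S_dom: "convex (S_dom e)" and bounded_S_dom: "bounded (S_dom e)"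
    and ball_subset_S_dom: "ball S_center (1 + e) \<subseteq> S_dom e" "ball (vector [1, 0]) 1 \<subseteq> S_dom e"
  using hull_subset[of "ball S_center (1 + e) \<union> ball (vector [1, 0]) 1" convex]
  by (auto simp: S_dom_def open_convex_hull convex_convex_hull bounded_convex_hull)

section \<open>Inradius and High ridge\<close>

lemma ball_bdist_subset: 
  assumes "x \<in> \<Omega>"
  shows "ball x (bdist \<Omega> x) \<subseteq> \<Omega>"
proof (rule ccontr)
  assume "\<not> ?thesis"
  then obtain y where y: "dist x y < bdist \<Omega> x" "y \<notin> \<Omega>" by (auto simp: subset_iff)
  then have "x \<in> ball x (bdist \<Omega> x)" using zero_le_dist[of x y] by (simp del: zero_le_dist)
  then have "ball x (bdist \<Omega> x) \<inter> \<Omega> \<noteq> {}" "ball x (bdist \<Omega> x) - \<Omega> \<noteq> {}"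
    using y assms by (blast, auto)
  then have "ball x (bdist \<Omega> x) \<inter> frontier \<Omega> \<noteq> {}"
    by (intro connected_Int_frontier connected_ball)
  then obtain w where "dist x w < bdist \<Omega> x" "w \<in> frontier \<Omega>" by auto
  then show False using infdist_le[of w "frontier \<Omega>" x] by (simp add: bdist_def)
qed

lemma le_bdist:
  assumes "open \<Omega>" "frontier \<Omega> \<noteq> {}" "ball x r \<subseteq> \<Omega>"
  shows "r \<le> bdist \<Omega> x"
  unfolding bdist_def infdist_notempty[OF assms(2)]
proof (rule cINF_greatest[OF assms(2)])
  fix w assume "w \<in> frontier \<Omega>"
  then have "w \<notin> \<Omega>" using \<open>open \<Omega>\<close> by (simp add: frontier_def interior_open)
  then show "r \<le> dist x w" using assms(3) by (auto simp: subset_iff not_less)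
qed

lemma S_center_in_S_dom: "0 < e \<Longrightarrow> S_center \<in> S_dom e"
  using ball_subset_S_dom(1)[of e] by (simp add: subset_iff)

lemma Lam_S_dom:
  assumes "0 < e"
  shows "Lam (S_dom e) = 1 / (1 + e)"
proof -
  have "Sup {r. \<exists>x\<in>S_dom e. ball x r \<subseteq> S_dom e} = 1 + e"
    using S_dom_ball_radius_le S_center_in_S_dom ball_subset_S_dom(1)[of e] assms
    by (intro cSup_eq_maximum) blast+
  then show ?thesis by (simp add: Lam_def inverse_eq_divide)
qed

text \<open>The distance to the frontier is the radius of the largest inscribed disk around a point,
  and \<open>S_dom_max_ball_center\<close> leaves one centre for the radius
  \<open>1 + e\<close>.\<close>

lemma high_ridge_S_dom:
  assumes e: "0 < e" "e < 1"
  shows "high_ridge (S_dom e) = {S_center}"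
proof -
  have c: "S_center \<in> S_dom e" using e by (simp add: S_center_in_S_dom)
  have "S_dom e \<noteq> UNIV" using bounded_S_dom not_bounded_UNIV by metis
  then have "frontier (S_dom e) \<noteq> {}" using c frontier_not_empty by blast
  then have "1 + e \<le> bdist (S_dom e) S_center"
    by (intro le_bdist open_S_dom ball_subset_S_dom)
  moreover have le: "bdist (S_dom e) x \<le> 1 + e" if "x \<in> S_dom e" for x
    using S_dom_ball_radius_le[OF that ball_bdist_subset[OF that]] e by simp
  ultimately have d: "bdist (S_dom e) S_center = 1 + e" using c by fastforce
  have "(SUP y\<in>S_dom e. bdist (S_dom e) y) = 1 + e"
    using c le by (intro cSup_eq_maximum) (auto simp: image_iff intro!: bexI[of _ S_center] d[symmetric])
  then have "high_ridge (S_dom e) = {x \<in> S_dom e. bdist (S_dom e) x = 1 + e}"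
    by (simp add: high_ridge_def)
  moreover have "x = S_center" if "x \<in> S_dom e" "bdist (S_dom e) x = 1 + e" for x
    using S_dom_max_ball_center[OF that(1) _ e] ball_bdist_subset[OF that(1)] that(2) by simp
  ultimately show ?thesis using c d by blast
qed

section \<open>Potentials that are eigenfunctions\<close>

lemma Int_frontier_subset:
  assumes "open D" "closure D \<subseteq> C"
  shows "frontier D \<subseteq> C - D"
  using assms by (auto simp: frontier_def interior_open)

lemma closure_Diff_subset: "closure (A - B) \<subseteq> closure A"
  by (simp add: closure_mono)

context
  fixes e :: real and v :: "pt \<Rightarrow> real"
  assumes e: "0 < e" "e < 1"
    and pot: "inf_harmonic_potential (S_dom e) v" and eig: "first_inf_eigenfunction (S_dom e) v"
begin

lemma cont_v: "continuous_on (closure (S_dom e)) v"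
  using pot by (simp add: inf_harmonic_potential_def)

lemma v_nonneg: "x \<in> closure (S_dom e) \<Longrightarrow> 0 \<le> v x"
  using eig by (simp add: first_inf_eigenfunction_def)

lemma v_frontier: "x \<in> frontier (S_dom e) \<Longrightarrow> v x = 0"
  using pot by (simp add: inf_harmonic_potential_def)

lemma v_center: "v S_center = 1"
  using pot e by (simp add: inf_harmonic_potential_def high_ridge_S_dom)

lemma v_eigen_eq: "visc_inf_eigen_eq (1 / (1 + e)) (S_dom e) v"
  using eig e by (simp add: first_inf_eigenfunction_def Lam_S_dom)

lemma v_subharmonic: "jet_subharmonic (S_dom e - {S_center}) v"
  using visc_inf_harmonic_jet_subharmonic pot e
  by (simp add: inf_harmonic_potential_def high_ridge_S_dom)

lemma minus_v_subharmonic: "jet_subharmonic (S_dom e) (\<lambda>x. - v x)"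
  using visc_inf_eigen_eq_jet_subharmonic_minus[OF v_eigen_eq] .

section \<open>Positivity of \<open>v\<close> and bounds from comparison with cones\<close>

lemma v_pos:
  assumes x: "x \<in> S_dom e"
  shows "0 < v x"
proof (rule ccontr)
  assume "\<not> 0 < v x"
  moreover have nonneg: "0 \<le> v y" if "y \<in> S_dom e" for y using v_nonneg that closure_subset by blast
  ultimately have v0: "v x = 0" using x by fastforce
  obtain r where r: "r > 0" "ball x r \<subseteq> S_dom e"
    using open_S_dom x open_contains_ball by blast
  \<comment> \<open>At a zero of \<open>v\<close> the zero function touches from below; as
    \<open>0 / 0\<close> is 0, the gradient bound reads \<open>1 / (1 + e) \<le> 0\<close>.\<close>
  have "1 / (1 + e) \<le> norm (0 :: pt) / v x"
  proof (rule visc_inf_eigen_eq_lower_jet(1)[OF v_eigen_eq x r(1), of 0 0])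
    fix h :: pt assume "norm h < r"
    then have "x + h \<in> S_dom e" using r by (auto simp: subset_iff dist_norm)
    then show "v x + 0 \<bullet> h + h \<bullet> (0 *v h) / 2 \<le> v (x + h)" using nonneg v0 by simp
  qed
  then show False using e by (simp add: divide_le_0_iff)
qed

text \<open>Comparison with the constant 1, a cone of slope 0, on the domain without
  \<open>S_center\<close>.\<close>

lemma v_le_1:
  assumes "x \<in> closure (S_dom e)"
  shows "v x \<le> 1"
proof -
  have "v x \<le> 1 + 0 * norm (x - S_center)" if x: "x \<in> S_dom e - {S_center}" for x
  proof (rule cone_comparison[OF _ _ _ v_subharmonic _ _ _ x])
    show op: "open (S_dom e - {S_center})" using open_S_dom by (simp add: open_Diff)
    show "bounded (S_dom e - {S_center})" using bounded_S_dom by (simp add: bounded_diff)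
    show "continuous_on (closure (S_dom e - {S_center})) v"
      using cont_v closure_Diff_subset by (rule continuous_on_subset)
    fix y assume "y \<in> frontier (S_dom e - {S_center})"
    then have "y \<in> closure (S_dom e)" "y \<notin> S_dom e \<or> y = S_center"
      using Int_frontier_subset[OF op closure_Diff_subset] by auto
    then show "v y \<le> 1 + 0 * norm (y - S_center)"
      using v_frontier[of y] v_center by (auto simp: frontier_def interior_open open_S_dom)
  qed auto
  then show ?thesis
    using assms v_center v_frontier[of x] by (cases "x \<in> S_dom e"; cases "x = S_center")
      (auto simp: frontier_def interior_open open_S_dom)
qed

lemma cball_subset_closure_S_dom: "cball S_center (1 + e) \<subseteq> closure (S_dom e)"
  using closure_mono[OF ball_subset_S_dom(1)[of e]] e by simp

text \<open>Comparison for \<open>- v\<close> on the punctured disk: the cone agrees with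
  \<open>v\<close> at the vertex and vanishes on the outer circle, where \<open>v\<close> is
  nonnegative.\<close>

lemma v_ge_cone:
  assumes "x \<in> cball S_center (1 + e)"
  shows "1 - norm (x - S_center) / (1 + e) \<le> v x"
proof -
  let ?D = "ball S_center (1 + e) - {S_center}"
  have cl: "closure ?D \<subseteq> cball S_center (1 + e)"
    using closure_Diff_subset[of "ball S_center (1 + e)"] e by simp
  have cone: "1 - norm (y - S_center) / (1 + e) \<le> v y"
    if "y \<in> cball S_center (1 + e)" "y \<notin> ?D" for y
  proof (cases "y = S_center")
    case False
    then have "norm (y - S_center) = 1 + e" using that by (auto simp: dist_norm norm_minus_commute)
    then show ?thesis using v_nonneg[OF subsetD[OF cball_subset_closure_S_dom that(1)]] e by simp
  qed (simp add: v_center)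
  have "- v x \<le> - 1 + 1 / (1 + e) * norm (x - S_center)" if x: "x \<in> ?D"
  proof (rule cone_comparison[OF _ _ _ _ _ _ _ x])
    show op: "open ?D" by (simp add: open_Diff)
    show "bounded ?D" by (simp add: bounded_diff)
    show "continuous_on (closure ?D) (\<lambda>x. - v x)"
      using cl cball_subset_closure_S_dom
      by (intro continuous_on_minus continuous_on_subset[OF cont_v]) blast
    show "jet_subharmonic ?D (\<lambda>x. - v x)"
      using ball_subset_S_dom(1)[of e] by (intro jet_subharmonic_subset[OF minus_v_subharmonic]) blast
    fix y assume "y \<in> frontier ?D"
    then show "- v y \<le> - 1 + 1 / (1 + e) * norm (y - S_center)"
      using cone[of y] Int_frontier_subset[OF op cl] by force
  qed (use e in auto)
  then show ?thesis using cone[OF assms] by (cases "x \<in> ?D") auto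
qed

text \<open>Where a paraboloid touches \<open>v\<close> from below with gradient \<open>g\<close>, the eigenvalue equation bounds \<open>norm g\<close>
  from below and comparison with cones from above bounds it from above; such points are dense.\<close>

lemma v_upper_bound:
  assumes x: "x \<noteq> S_center" "norm (x - S_center) < (1 + e) / 2"
  shows "v x * (1 + norm (x - S_center) / (1 + e)) \<le> 1"
proof (rule ccontr)
  assume neg: "\<not> ?thesis"
  define F where "F y = v y * (1 + norm (y - S_center) / (1 + e))" for y
  let ?U = "ball S_center ((1 + e) / 2) - {S_center}"
  have U: "?U \<subseteq> S_dom e" using ball_subset_S_dom(1)[of e] e by (auto simp: subset_iff)
  have "continuous_on ?U F"
    unfolding F_def using U closure_subset e
    by (intro continuous_intros continuous_on_subset[OF cont_v]) auto
  moreover have "open ?U" by (simp add: open_Diff)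
  ultimately have "open (?U \<inter> F -` {1<..})"
    by (simp add: continuous_on_open_vimage Int_commute)
  moreover have "x \<in> ?U \<inter> F -` {1<..}"
    using x neg by (simp add: F_def dist_norm norm_minus_commute)
  ultimately obtain \<delta> where \<delta>: "\<delta> > 0" "cball x \<delta> \<subseteq> ?U \<inter> F -` {1<..}"
    using open_contains_cball by blast
  \<comment> \<open>On the sphere of radius \<open>\<delta>\<close> the penalty is 2, more than the
    oscillation of \<open>v\<close>, so the minimum below is interior.\<close>
  define K where "K = 2 / \<delta>\<^sup>2"
  have K: "K > 0" using \<delta> by (simp add: K_def)
  have "continuous_on (cball x \<delta>) (\<lambda>y. v y + K * (norm (y - x))\<^sup>2)"
    using \<delta> U closure_subset by (intro continuous_intros continuous_on_subset[OF cont_v]) blast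
  moreover have "cball x \<delta> \<noteq> {}" using \<delta> by simp
  ultimately obtain z where z: "z \<in> cball x \<delta>"
    and zmin: "\<And>y. y \<in> cball x \<delta> \<Longrightarrow> v z + K * (norm (z - x))\<^sup>2 \<le> v y + K * (norm (y - x))\<^sup>2"
    using continuous_attains_inf[OF compact_cball] by blast
  have zU: "z \<in> ?U" "F z > 1" using z \<delta> by auto
  have zS: "z \<in> S_dom e" using zU U by blast
  define R where "R = norm (z - S_center)"
  have R: "R > 0" "2 * R < 1 + e" using zU by (auto simp: R_def dist_norm norm_minus_commute)
  have "norm (z - x) < \<delta>"
  proof (rule ccontr)
    assume "\<not> norm (z - x) < \<delta>"
    then have "norm (z - x) = \<delta>" using z by (simp add: dist_norm norm_minus_commute)
    then have "v z + 2 \<le> v x" using zmin[of x] \<delta> by (simp add: K_def)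
    moreover have "x \<in> S_dom e" using \<delta> U by (auto simp: subset_iff)
    ultimately show False using v_le_1[of x] v_pos[OF zS] closure_subset by fastforce
  qed
  then have r: "\<delta> - norm (z - x) > 0" by simp
  \<comment> \<open>Gradient at \<open>z\<close> of the touching paraboloid, whose quadratic part is
    \<open>- K * (norm (y - x))\<^sup>2\<close>.\<close>
  define g where "g = (- 2 * K) *\<^sub>R (z - x)"
  have below: "v z + g \<bullet> h - K * (norm h)\<^sup>2 \<le> v (z + h)" if "norm h < \<delta> - norm (z - x)" for h
  proof -
    have "norm (z + h - x) \<le> norm (z - x) + norm h" using norm_triangle_ineq[of "z - x" h] by (simp add: algebra_simps)
    then have "z + h \<in> cball x \<delta>" using that by (simp add: dist_norm norm_minus_commute)
    then have "v z + K * (norm (z - x))\<^sup>2 \<le> v (z + h) + K * (norm ((z - x) + h))\<^sup>2"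
      using zmin[of "z + h"] by (simp add: algebra_simps)
    also have "(norm ((z - x) + h))\<^sup>2 = (norm (z - x))\<^sup>2 + 2 * ((z - x) \<bullet> h) + (norm h)\<^sup>2"
      by (simp add: power2_norm_eq_inner inner_add_left inner_add_right inner_commute)
    finally show ?thesis by (simp add: g_def algebra_simps)
  qed
  have "1 / (1 + e) \<le> norm g / v z"
  proof (rule visc_inf_eigen_eq_lower_jet(1)[OF v_eigen_eq zS r, of g "(- 2 * K) *\<^sub>R mat 1"])
    fix h :: pt assume "norm h < \<delta> - norm (z - x)"
    from below[OF this] show "v z + g \<bullet> h + h \<bullet> (((- 2 * K) *\<^sub>R mat 1) *v h) / 2 \<le> v (z + h)"
      by (simp only: scaleR_matrix_vector_assoc[symmetric] matrix_vector_mul_lid) (simp add: power2_norm_eq_inner)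
  qed
  then have lower: "v z / (1 + e) \<le> norm g" using v_pos[OF zS] e by (simp add: field_simps)
  \<comment> \<open>Slope of the cone with vertex \<open>z\<close> that rises from
    \<open>v z\<close> to the bound 1 on the sphere of radius \<open>R\<close>. This sphere passes
    through \<open>S_center\<close>, so the open ball avoids it and \<open>v_subharmonic\<close>
    applies.\<close>
  define B where "B = (1 - v z) / R"
  have vz1: "v z \<le> 1" using v_le_1 zS closure_subset by blast
  then have B: "B \<ge> 0" using R by (simp add: B_def)
  have ball: "cball z R \<subseteq> ball S_center (1 + e)"
  proof
    fix y assume "y \<in> cball z R"
    then show "y \<in> ball S_center (1 + e)"
      using dist_triangle[of S_center y z] R by (simp add: R_def dist_norm norm_minus_commute)
  qed
  have above: "v y \<le> v z + B * norm (y - z)" if y: "y \<in> ball z R - {z}" for y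
  proof (rule cone_comparison[OF _ _ _ _ _ B _ y])
    show op: "open (ball z R - {z})" by (simp add: open_Diff)
    show "bounded (ball z R - {z})" by (simp add: bounded_diff)
    have cl: "closure (ball z R - {z}) \<subseteq> cball z R"
      using closure_Diff_subset[of "ball z R"] R by simp
    then show "continuous_on (closure (ball z R - {z})) v"
      using ball ball_subset_S_dom(1)[of e] closure_subset
      by (intro continuous_on_subset[OF cont_v]) blast
    have "S_center \<notin> ball z R" by (simp add: R_def dist_norm)
    then show "jet_subharmonic (ball z R - {z}) v"
      using ball ball_subset_S_dom(1)[of e] ball_subset_cball[of z R]
      by (intro jet_subharmonic_subset[OF v_subharmonic]) blast
    fix w assume "w \<in> frontier (ball z R - {z})"
    then have w: "w \<in> cball z R" "w = z \<or> w \<notin> ball z R" using Int_frontier_subset[OF op cl] by auto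
    show "v w \<le> v z + B * norm (w - z)"
    proof (cases "w = z")
      case False
      then have "norm (w - z) = R" using w by (auto simp: dist_norm norm_minus_commute)
      moreover have "v w \<le> 1"
        using w ball ball_subset_S_dom(1)[of e] closure_subset by (intro v_le_1) blast
      ultimately show ?thesis using R by (simp add: B_def)
    qed simp
  qed simp
  have "norm g \<le> B"
  proof (rule norm_le_of_cone_bound[OF _ K B])
    show "min (\<delta> - norm (z - x)) R > 0" using r R by simp
    fix h :: pt assume h: "norm h < min (\<delta> - norm (z - x)) R"
    then have "v (z + h) \<le> v z + B * norm h"
      using above[of "z + h"] by (cases "h = 0") (auto simp: dist_norm)
    then show "g \<bullet> h - K * (norm h)\<^sup>2 \<le> B * norm h" using below[of h] h by simp
  qed
  \<comment> \<open>The lower and upper bounds on \<open>norm g\<close> combine and rearrange to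
    \<open>F z \<le> 1\<close>.\<close>
  then have "v z / (1 + e) \<le> (1 - v z) / R" using lower by (simp add: B_def)
  then have "v z / (1 + e) * R \<le> 1 - v z" using R by (simp add: pos_le_divide_eq)
  then have "F z \<le> 1" by (simp add: F_def R_def[symmetric] algebra_simps)
  then show False using zU by simp
qed

text \<open>The barrier is compared with \<open>v\<close> on a thin sector of the disk. On the
  straight sides it is the cone of \<open>v_ge_cone\<close>; on the arc the cone vanishes and the
  room comes from \<open>v > \<eta>\<close> near \<open>y0\<close>. On the axis the gain has the
  constant \<open>k = a * (1 - c)\<^sup>2\<close>.\<close>

lemma v_ge_barrier:
  fixes u :: pt
  defines "u \<equiv> vector [1, 0]"
  obtains k where "k > 0"
    "\<And>t. \<lbrakk>0 < t; t < 1 + e\<rbrakk> \<Longrightarrow> 1 - t / (1 + e) + k * (t * sqrt t) \<le> v (S_center + t *\<^sub>R u)"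
proof -
  define \<rho> where "\<rho> = 1 + e"
  have \<rho>: "\<rho> > 1" using e by (simp add: \<rho>_def)
  have u: "norm u = 1" "u \<bullet> u = 1" by (auto simp: u_def norm_eq_1 inner_vec_def sum_2)
  \<comment> \<open>The point \<open>(e, 0)\<close>: on the circle around \<open>S_center\<close>,
    yet inside the small disk.\<close>
  define y0 where "y0 = S_center + \<rho> *\<^sub>R u"
  have "dist (vector [1, 0]) y0 = norm ((1 - e) *\<^sub>R u)"
    unfolding dist_norm by (rule arg_cong[of _ _ norm]) (simp add: y0_def u_def \<rho>_def vec_eq_iff forall_2)
  then have "y0 \<in> ball (vector [1, 0]) 1" using u e by simp
  then have y0: "y0 \<in> S_dom e" using ball_subset_S_dom(2) by blast
  define \<eta> where "\<eta> = v y0 / 2"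
  have \<eta>: "\<eta> > 0" "\<eta> < v y0" using v_pos[OF y0] by (auto simp: \<eta>_def)
  have "isCont v y0"
    using cont_v y0 closure_subset open_S_dom
    by (meson continuous_on_eq_continuous_at continuous_on_subset)
  then have "\<forall>\<^sub>F y in nhds y0. \<eta> < v y"
    using \<eta>(2) by (metis isCont_def order_tendstoD(1) tendsto_at_iff_tendsto_nhds)
  then obtain d where d: "d > 0" "\<And>y. dist y y0 < d \<Longrightarrow> \<eta> < v y"
    unfolding eventually_nhds_metric by blast
  \<comment> \<open>Arc points of the sector have squared distance at most
    \<open>2 * \<rho>\<^sup>2 * (1 - c)\<close> from \<open>y0\<close>, which this choice makes at
    most \<open>d\<^sup>2 / 2\<close>; the bound 1/2 keeps \<open>c\<close> positive.\<close>
  define c where "c = max (1 / 2) (1 - d\<^sup>2 / (4 * \<rho>\<^sup>2))"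
  have c: "0 < c" "c < 1" using d \<rho> by (auto simp: c_def)
  have "1 - d\<^sup>2 / (4 * \<rho>\<^sup>2) \<le> c" by (simp add: c_def)
  then have "2 * \<rho>\<^sup>2 * (1 - c) \<le> 2 * \<rho>\<^sup>2 * (d\<^sup>2 / (4 * \<rho>\<^sup>2))"
    by (intro mult_left_mono) auto
  also have "\<dots> < d\<^sup>2" using \<rho> d by simp
  finally have cd: "2 * \<rho>\<^sup>2 * (1 - c) < d\<^sup>2" .
  \<comment> \<open>The entry \<open>\<eta>\<close> keeps the barrier below \<open>v\<close> on the
    arc; 1/256 gives the smallness condition with a factor 2 to spare.\<close>
  define a where "a = min \<eta> (1 / 256) / (\<rho> * sqrt \<rho>)"
  have a: "a > 0" using \<eta> \<rho> by (simp add: a_def)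
  have as: "a * (\<rho> * sqrt \<rho>) = min \<eta> (1 / 256)" using \<rho> by (simp add: a_def)
  have small: "128 * (a * sqrt \<rho>) < 1 / \<rho>"
  proof -
    have "128 * (a * sqrt \<rho>) * \<rho> = 128 * min \<eta> (1 / 256)" using as by (simp add: mult_ac)
    also have "\<dots> < 1" by simp
    finally show ?thesis using \<rho> by (simp add: pos_less_divide_eq)
  qed
  obtain G L where GL:
    "\<And>x. \<lbrakk>norm (x - S_center) \<le> \<rho>; c * norm (x - S_center) < u \<bullet> (x - S_center)\<rbrakk> \<Longrightarrow>
       (barrier S_center u (1 / \<rho>) a c has_derivative (\<lambda>h. G x \<bullet> h)) (at x)"
    "\<And>x. \<lbrakk>norm (x - S_center) \<le> \<rho>; c * norm (x - S_center) < u \<bullet> (x - S_center)\<rbrakk> \<Longrightarrow> (G has_derivative L x) (at x)"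
    "\<And>x. \<lbrakk>norm (x - S_center) \<le> \<rho>; c * norm (x - S_center) < u \<bullet> (x - S_center)\<rbrakk> \<Longrightarrow> 0 < G x \<bullet> L x (G x)"
    using barrier_derivatives[OF u(1) a c(1) small] by metis
  define D where "D = ball S_center \<rho> \<inter> {x. c * norm (x - S_center) < u \<bullet> (x - S_center)}"
  have cl: "closure D \<subseteq> cball S_center \<rho> \<inter> {x. c * norm (x - S_center) \<le> u \<bullet> (x - S_center)}"
    by (rule closure_minimal) (auto simp: D_def intro!: closed_Int closed_Collect_le continuous_intros)
  have op: "open D" unfolding D_def by (intro open_Int open_ball open_Collect_less continuous_intros)
  have bar: "barrier S_center u (1 / \<rho>) a c x \<le> v x" if x: "x \<in> D" for x
  proof -
    \<comment> \<open>Subharmonicity is at hand for \<open>- v\<close>, so the barrier is negated as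
      well, which flips the sign of its second-order expression.\<close>
    have "- v x \<le> - barrier S_center u (1 / \<rho>) a c x"
    proof (rule strict_comparison[where D=D and f="\<lambda>x. - barrier S_center u (1 / \<rho>) a c x"
          and G="\<lambda>x. - G x" and L="\<lambda>x h. - L x h", OF op _ _ _ _ _ _ _ x])
      show "bounded D" by (auto simp: D_def)
      have "D \<subseteq> S_dom e" using ball_subset_S_dom(1)[of e] by (auto simp: D_def \<rho>_def)
      then show "jet_subharmonic D (\<lambda>x. - v x)" by (rule jet_subharmonic_subset[OF minus_v_subharmonic])
      have "continuous_on (closure D) v"
        using cl cball_subset_closure_S_dom by (intro continuous_on_subset[OF cont_v]) (auto simp: \<rho>_def)
      then show "continuous_on (closure D) (\<lambda>x. - v x - - barrier S_center u (1 / \<rho>) a c x)"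
        by (intro continuous_intros continuous_on_subset[OF continuous_on_barrier]) auto
    next
      fix y assume "y \<in> D"
      then have y: "norm (y - S_center) \<le> \<rho>" "c * norm (y - S_center) < u \<bullet> (y - S_center)"
        by (auto simp: D_def dist_norm norm_minus_commute)
      note GLy = GL(1)[OF y] GL(2)[OF y] GL(3)[OF y]
      show "((\<lambda>x. - barrier S_center u (1 / \<rho>) a c x) has_derivative (\<lambda>h. (- G y) \<bullet> h)) (at y)"
        using has_derivative_minus[OF GLy(1)] by simp
      show "((\<lambda>x. - G x) has_derivative (\<lambda>h. - L y h)) (at y)"
        using has_derivative_minus[OF GLy(2)] .
      have "L y (- G y) = - L y (G y)"
        using GLy(2) by (simp add: has_derivative_bounded_linear bounded_linear.linear linear_neg)
      then show "(- G y) \<bullet> - L y (- G y) < 0" using GLy(3) by simp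
    next
      fix y assume "y \<in> frontier D"
      then have y: "norm (y - S_center) \<le> \<rho>" "c * norm (y - S_center) \<le> u \<bullet> (y - S_center)"
        "norm (y - S_center) = \<rho> \<or> c * norm (y - S_center) = u \<bullet> (y - S_center)"
        using Int_frontier_subset[OF op cl] by (auto simp: D_def dist_norm norm_minus_commute)
      have "barrier S_center u (1 / \<rho>) a c y \<le> v y"
      proof (cases "c * norm (y - S_center) = u \<bullet> (y - S_center)")
        \<comment> \<open>A side of the sector, vertex included: the correction term
          vanishes.\<close>
        case True
        then show ?thesis
          using v_ge_cone[of y] y(1) by (simp add: barrier_def \<rho>_def dist_norm norm_minus_commute)
      next
        case False
        with y have n: "norm (y - S_center) = \<rho>" by simp
        define X where "X = u \<bullet> (y - S_center)"
        have X: "c * \<rho> \<le> X" "X \<le> \<rho>"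
          using y(2) norm_cauchy_schwarz[of u "y - S_center"] n u by (auto simp: X_def)
        have "(dist y y0)\<^sup>2 = (norm ((y - S_center) - \<rho> *\<^sub>R u))\<^sup>2"
          by (simp add: dist_norm y0_def algebra_simps)
        also have "\<dots> = (norm (y - S_center))\<^sup>2 + \<rho>\<^sup>2 * (u \<bullet> u) - 2 * \<rho> * X"
        proof -
          have "(norm (w - \<rho> *\<^sub>R u))\<^sup>2 = (norm w)\<^sup>2 + \<rho>\<^sup>2 * (u \<bullet> u) - 2 * \<rho> * (u \<bullet> w)" for w
            unfolding power2_norm_eq_inner by (simp add: inner_diff_left inner_diff_right inner_commute[of w u]
                power2_eq_square algebra_simps)
          then show ?thesis by (simp only: X_def)
        qed
        also have "\<dots> = 2 * \<rho>\<^sup>2 - 2 * \<rho> * X" using n u by simp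
        also have "\<dots> \<le> 2 * \<rho>\<^sup>2 - 2 * \<rho> * (c * \<rho>)"
          using X \<rho> by (intro diff_left_mono mult_left_mono) auto
        also have "\<dots> = 2 * \<rho>\<^sup>2 * (1 - c)" by (simp add: power2_eq_square algebra_simps)
        also have "\<dots> < d\<^sup>2" by (rule cd)
        finally have "dist y y0 < d" using d by (simp add: power2_less_imp_less)
        then have "\<eta> < v y" by (rule d)
        have "(X - c * \<rho>)\<^sup>2 \<le> \<rho>\<^sup>2"
        proof (rule power_mono)
          have "0 \<le> c * \<rho>" using c \<rho> by simp
          then show "X - c * \<rho> \<le> \<rho>" using X by linarith
        qed (use X in simp)
        then have "a * (X - c * \<rho>)\<^sup>2 / sqrt \<rho> \<le> a * \<rho>\<^sup>2 / sqrt \<rho>"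
          using a \<rho> by (intro divide_right_mono mult_left_mono) auto
        also have "\<dots> = a * (\<rho> * sqrt \<rho>)"
        proof -
          have "a * \<rho>\<^sup>2 / sqrt \<rho> = a * (\<rho> * (\<rho> / sqrt \<rho>))" by (simp add: power2_eq_square)
          then show ?thesis using \<rho> by (simp add: real_div_sqrt)
        qed
        also have "\<dots> \<le> \<eta>" unfolding as by simp
        finally have "a * (X - c * \<rho>)\<^sup>2 / sqrt \<rho> \<le> \<eta>" .
        then show ?thesis using \<open>\<eta> < v y\<close> \<rho> by (simp add: barrier_def n X_def)
      qed
      then show "- v y \<le> - barrier S_center u (1 / \<rho>) a c y" by simp
    qed
    then show ?thesis by simp
  qed
  show thesis
  proof (rule that)
    show "a * (1 - c)\<^sup>2 > 0" using a c by simp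
    fix t :: real assume t: "0 < t" "t < 1 + e"
    have ut: "u \<bullet> (t *\<^sub>R u) = t" "norm (t *\<^sub>R u) = t" using u t by auto
    have "S_center + t *\<^sub>R u \<in> D"
      using t c ut by (simp add: D_def \<rho>_def dist_norm)
    from bar[OF this] have "1 - t / (1 + e) + a * (t - c * t)\<^sup>2 / sqrt t \<le> v (S_center + t *\<^sub>R u)"
      unfolding barrier_def add_diff_cancel_left' ut by (simp add: \<rho>_def)
    moreover have "a * (t - c * t)\<^sup>2 / sqrt t = a * (1 - c)\<^sup>2 * (t * sqrt t)"
    proof -
      have "a * (t - c * t)\<^sup>2 / sqrt t = a * (1 - c)\<^sup>2 * (t * (t / sqrt t))"
      proof -
        have "(t - c * t)\<^sup>2 = (1 - c)\<^sup>2 * (t * t)" by (simp add: power2_eq_square algebra_simps)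
        then show ?thesis by (simp only: mult.assoc times_divide_eq_right)
      qed
      then show ?thesis using t by (simp only: real_div_sqrt less_imp_le)
    qed
    ultimately show "1 - t / (1 + e) + a * (1 - c)\<^sup>2 * (t * sqrt t) \<le> v (S_center + t *\<^sub>R u)" by simp
  qed
qed

text \<open>On the axis at distance \<open>t\<close> the two bounds combine to
  \<open>k * t powr (3/2) \<le> l\<^sup>2 \<le> t\<^sup>2\<close>, which fails for small
  \<open>t\<close>.\<close>

lemma potential_eigenfunction_contradiction: False
proof -
  obtain k where k: "k > 0" and lower: "\<And>t. \<lbrakk>0 < t; t < 1 + e\<rbrakk> \<Longrightarrow>
      1 - t / (1 + e) + k * (t * sqrt t) \<le> v (S_center + t *\<^sub>R vector [1, 0])"
    using v_ge_barrier by blast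
  \<comment> \<open>\<open>s\<close> is \<open>sqrt t\<close>: \<open>s \<le> k / 2\<close> gives
    \<open>t * t \<le> (k / 2) * (t * s)\<close>, and \<open>s \<le> 1 / 2\<close> keeps the point
    in the range of \<open>v_upper_bound\<close>.\<close>
  define s where "s = min (1 / 2) (k / 2)"
  have s: "0 < s" "s \<le> 1 / 2" "s \<le> k / 2" using k by (auto simp: s_def)
  define t where "t = s\<^sup>2"
  have st: "sqrt t = s" using s by (simp add: t_def)
  have "s\<^sup>2 \<le> (1 / 2)\<^sup>2" using s by (intro power_mono) auto
  then have t: "0 < t" "t \<le> 1 / 4" using s by (auto simp: t_def power2_eq_square)
  define l where "l = t / (1 + e)"
  have l: "0 < l" "l \<le> t" using t e by (auto simp: l_def field_simps)
  define x :: pt where "x = S_center + t *\<^sub>R vector [1, 0]"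
  have n: "norm (x - S_center) = t"
  proof -
    have "norm (vector [1, 0] :: pt) = 1" by (simp add: norm_eq_1 inner_vec_def sum_2)
    then show ?thesis using t by (simp add: x_def)
  qed
  then have "x \<noteq> S_center" "norm (x - S_center) < (1 + e) / 2" using t e by auto
  from v_upper_bound[OF this] have "v x * (1 + l) \<le> 1" by (simp add: n l_def)
  moreover have "(1 - l + k * (t * s)) * (1 + l) \<le> v x * (1 + l)"
    using lower[of t] t e l by (intro mult_right_mono) (auto simp: x_def l_def st)
  ultimately have "(1 - l + k * (t * s)) * (1 + l) \<le> 1" by linarith
  then have "k * (t * s) + k * (t * s) * l \<le> l * l" by (simp add: algebra_simps)
  moreover have "0 \<le> k * (t * s) * l" using k t s l by simp
  moreover have "l * l \<le> t * t" using l by (intro mult_mono) auto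
  moreover have "t * t \<le> (k / 2) * (t * s)"
    using mult_right_mono[OF s(3), of "t * s"] t s by (simp add: t_def power2_eq_square mult_ac)
  moreover have "k * (t * s) > 0" using k t s by simp
  ultimately show False by linarith
qed

end

theorem mainTheorem1:
  shows "(\<exists>e0>0. \<forall>e. 0 < e \<and> e < e0 \<longrightarrow>
            (\<forall>v. inf_harmonic_potential (S_dom e) v \<longrightarrow> \<not> first_inf_eigenfunction (S_dom e) v))
       \<and> (\<exists>\<Omega>::pt set. open \<Omega> \<and> connected \<Omega> \<and> \<Omega> \<noteq> {} \<and> bounded \<Omega> \<and> convex \<Omega> \<and>
            (\<forall>v. inf_harmonic_potential \<Omega> v \<longrightarrow> \<not> first_inf_eigenfunction \<Omega> v))"
proof -
  have main: "\<not> first_inf_eigenfunction (S_dom e) v"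
    if "0 < e" "e < 1" "inf_harmonic_potential (S_dom e) v" for e v
    using potential_eigenfunction_contradiction[OF that(1,2,3)] by (rule notI)
  show ?thesis
  proof
    show "\<exists>e0>0. \<forall>e. 0 < e \<and> e < e0 \<longrightarrow>
            (\<forall>v. inf_harmonic_potential (S_dom e) v \<longrightarrow> \<not> first_inf_eigenfunction (S_dom e) v)"
      using main by (intro exI[of _ 1]) auto
    have "S_dom (1 / 2) \<noteq> {}" using S_center_in_S_dom[of "1 / 2"] by auto
    then show "\<exists>\<Omega>::pt set. open \<Omega> \<and> connected \<Omega> \<and> \<Omega> \<noteq> {} \<and> bounded \<Omega> \<and> convex \<Omega> \<and>
            (\<forall>v. inf_harmonic_potential \<Omega> v \<longrightarrow> \<not> first_inf_eigenfunction \<Omega> v)"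
      using main[of "1 / 2"] open_S_dom convex_S_dom bounded_S_dom
      by (intro exI[of _ "S_dom (1 / 2)"]) (auto simp: convex_connected)
  qed
qed

end
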